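(* (1) There is a metric space $X$ whose $1$-growth function $\gamma(r)=\gamma^1(r)$ satisfies $$\lim_{r\to\infty}\frac{\gamma(r)}{r}=0$$ and which has infinite asymptotic Assouad-Nagata dimension. (2) There is a connected graph $G=(V,E)$ whose growth function $\gamma(r)=\sup\{|B_v(r)|: v\in V\}$ satisfies $$\lim_{r\to\infty}\frac{\gamma(r)}{r^{1+\epsilon}}=0\quad\text{for any }\epsilon>0$$ and which has infinite asymptotic Assouad-Nagata dimension.
   Context: Let $X$ be a metric space and $t>0$. A $(t,t)$-net of $X$ is a subset $N\subset X$ such that for any $x\in X$ there is $p\in N$ with $d(x,p)\le t$, and $d(p_1,p_2)\ge t$ for any two distinct $p_1,p_2\in N$. The $t$-growth function of $X$ is $$\gamma^t(r)=\sup\{|B_v(r)\cap N|: v\in X,\ N\text{ a }(t,t)\text{-net of }X\},$$ where $B_v(r)$ is the ball of radius $r$ centered at $v$. A connected graph $G=(V,E)$ is viewed as a geodesic metric space in which each edge has length $1$; for $A\subset G$, $|A|$ denotes the number of vertices in $A$. The asymptotic Assouad-Nagata dimension of a metric space $X$ is bounded by $n$ if there is a linear function $D(m)=Cm+C'$ (with constants $C,C'>0$) such that for every $m>0$ there is a covering $\mathcal U$ of $X$ by sets of diameter $\le D(m)$ such that any ball of radius $m$ in $X$ intersects at most $n+1$ elements of $\mathcal U$. It is infinite if it is not bounded by any $n\in\mathbb N$. *)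

theory Defs
  imports "HOL-Analysis.Analysis"
begin

context Metric_space
begin

definition net :: "real \<Rightarrow> 'a set \<Rightarrow> bool" where
  "net t N \<longleftrightarrow> N \<subseteq> M \<and> (\<forall>x\<in>M. \<exists>p\<in>N. d x p \<le> t) \<and>
     (\<forall>p\<in>N. \<forall>q\<in>N. p \<noteq> q \<longrightarrow> t \<le> d p q)"

text \<open>Balls are closed. Cardinalities are taken in the extended nonnegative reals (counting
  measure), so an infinite set, or an unbounded family of finite sets, yields \<open>\<infinity>\<close>.\<close>

definition net_growth :: "real \<Rightarrow> real \<Rightarrow> ennreal" where
  "net_growth t r =
     (SUP (v, N)\<in>M \<times> {N. net t N}. emeasure (count_space UNIV) (mcball v r \<inter> N))"

definition asymp_AN_dim_le :: "nat \<Rightarrow> bool" where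
  "asymp_AN_dim_le n \<longleftrightarrow>
     (\<exists>C>0. \<exists>C'>0. \<forall>m>0. \<exists>\<U>. \<Union>\<U> = M \<and>
        (\<forall>U\<in>\<U>. \<forall>x\<in>U. \<forall>y\<in>U. d x y \<le> C * m + C') \<and>
        (\<forall>x\<in>M. finite {U\<in>\<U>. U \<inter> mcball x m \<noteq> {}} \<and>
                card {U\<in>\<U>. U \<inter> mcball x m \<noteq> {}} \<le> n + 1))"

definition infinite_asymp_AN_dim :: bool where
  "infinite_asymp_AN_dim \<longleftrightarrow> (\<forall>n. \<not> asymp_AN_dim_le n)"

end

definition simple_graph :: "'v set \<Rightarrow> 'v set set \<Rightarrow> bool" where
  "simple_graph V E \<longleftrightarrow> (\<forall>e\<in>E. e \<subseteq> V \<and> card e = 2)"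

definition connected_graph :: "'v set \<Rightarrow> 'v set set \<Rightarrow> bool" where
  "connected_graph V E \<longleftrightarrow> simple_graph V E \<and> V \<noteq> {} \<and>
     (\<forall>u\<in>V. \<forall>v\<in>V. (u, v) \<in> {(a, b). {a, b} \<in> E}\<^sup>*)"

text \<open>A point of the geometric realization is given by its barycentric coordinates: it is a
  convex combination of the endpoints of an edge, or a vertex.\<close>

definition cell :: "'v set \<Rightarrow> ('v \<Rightarrow> real) set" where
  "cell e = {x. (\<forall>w. 0 \<le> x w) \<and> (\<forall>w. w \<notin> e \<longrightarrow> x w = 0) \<and> sum x e = 1}"

definition vertex_point :: "'v \<Rightarrow> 'v \<Rightarrow> real" where
  "vertex_point v = indicator {v}"

definition realization :: "'v set \<Rightarrow> 'v set set \<Rightarrow> ('v \<Rightarrow> real) set" where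
  "realization V E = vertex_point ` V \<union> (\<Union>e\<in>E. cell e)"

text \<open>\<open>pl_path V E x y l\<close>: there is a piecewise linear path of length \<open>l\<close> from \<open>x\<close> to \<open>y\<close>, each
  piece of which stays in one edge. Two points \<open>x\<close>, \<open>y\<close> of an edge of length one are at distance
  \<open>\<bar>x u - y u\<bar>\<close> along that edge, whichever of its endpoints \<open>u\<close> is used.\<close>

inductive pl_path ::
  "'v set \<Rightarrow> 'v set set \<Rightarrow> ('v \<Rightarrow> real) \<Rightarrow> ('v \<Rightarrow> real) \<Rightarrow> real \<Rightarrow> bool"
  for V E where
  refl: "x \<in> realization V E \<Longrightarrow> pl_path V E x x 0"
| step: "\<lbrakk>e \<in> E; u \<in> e; x \<in> cell e; y \<in> cell e; pl_path V E y z l\<rbrakk>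
    \<Longrightarrow> pl_path V E x z (\<bar>x u - y u\<bar> + l)"

text \<open>Meaningful for connected graphs only; otherwise the infimum may be over the empty set.\<close>

definition graph_dist ::
  "'v set \<Rightarrow> 'v set set \<Rightarrow> ('v \<Rightarrow> real) \<Rightarrow> ('v \<Rightarrow> real) \<Rightarrow> real" where
  "graph_dist V E x y =
     (if x \<in> realization V E \<and> y \<in> realization V E then Inf {l. pl_path V E x y l} else 0)"

definition graph_growth :: "'v set \<Rightarrow> 'v set set \<Rightarrow> real \<Rightarrow> ennreal" where
  "graph_growth V E r =
     (SUP v\<in>V. emeasure (count_space UNIV)
        {w\<in>V. vertex_point w \<in>
          Metric_space.mcball (realization V E) (graph_dist V E) (vertex_point v) r})"

lemma cell_pair_diff:
  assumes e: "card e = 2" "u \<in> e" and xy: "x \<in> cell e" "y \<in> cell e"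
  shows "\<bar>x w - y w\<bar> \<le> \<bar>x u - y u\<bar>" and "w \<in> e \<Longrightarrow> \<bar>x w - y w\<bar> = \<bar>x u - y u\<bar>"
proof -
  obtain v where v: "e = {u, v}" "u \<noteq> v"
    using e by (auto simp: card_2_iff doubleton_eq_iff)
  have s: "x u + x v = 1" "y u + y v = 1"
    using xy v by (auto simp: cell_def)
  show *: "w \<in> e \<Longrightarrow> \<bar>x w - y w\<bar> = \<bar>x u - y u\<bar>" for w
    using s v by auto
  show "\<bar>x w - y w\<bar> \<le> \<bar>x u - y u\<bar>"
    using * xy by (cases "w \<in> e") (auto simp: cell_def)
qed

lemma vertex_point_in_cell: "card e = 2 \<Longrightarrow> v \<in> e \<Longrightarrow> vertex_point v \<in> cell e"
  by (auto simp: cell_def vertex_point_def card_2_iff indicator_def)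

lemma pl_path_ends: "pl_path V E x y l \<Longrightarrow> x \<in> realization V E \<and> y \<in> realization V E"
  by (induction rule: pl_path.induct) (auto simp: realization_def)

lemma pl_path_nonneg: "pl_path V E x y l \<Longrightarrow> 0 \<le> l"
  by (induction rule: pl_path.induct) auto

lemma pl_path_lower:
  "pl_path V E x y l \<Longrightarrow> simple_graph V E \<Longrightarrow> \<bar>x w - y w\<bar> \<le> l"
proof (induction rule: pl_path.induct)
  case (step e u x y z l)
  then have "\<bar>x w - y w\<bar> \<le> \<bar>x u - y u\<bar>"
    by (intro cell_pair_diff) (auto simp: simple_graph_def)
  with step show ?case by simp
qed auto

lemma pl_path_trans:
  "pl_path V E x y l \<Longrightarrow> pl_path V E y z k \<Longrightarrow> pl_path V E x z (l + k)"
proof (induction rule: pl_path.induct)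
  case (step e u x y z' l)
  then show ?case
    using pl_path.step[of e E u x y V z "l + k"] by (simp add: add.assoc)
qed auto

lemma pl_path_edge:
  assumes "e \<in> E" "u \<in> e" "x \<in> cell e" "y \<in> cell e"
  shows "pl_path V E x y \<bar>x u - y u\<bar>"
proof -
  have "y \<in> realization V E" using assms by (auto simp: realization_def)
  from pl_path.step[OF assms pl_path.refl[OF this]] show ?thesis by simp
qed

lemma pl_path_sym: "pl_path V E x y l \<Longrightarrow> pl_path V E y x l"
proof (induction rule: pl_path.induct)
  case (step e u x y z l)
  then have "pl_path V E z x (l + \<bar>y u - x u\<bar>)"
    by (intro pl_path_trans[OF _ pl_path_edge[of e]])
  then show ?case by (simp add: abs_minus_commute add.commute)
qed (rule pl_path.refl)

lemma pl_path_exists: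
  assumes G: "connected_graph V E" and x: "x \<in> realization V E" and y: "y \<in> realization V E"
  shows "\<exists>l. pl_path V E x y l"
proof -
  have card2: "card e = 2" "e \<subseteq> V" if "e \<in> E" for e
    using G that by (auto simp: connected_graph_def simple_graph_def)
  have vert: "\<exists>v\<in>V. \<exists>l. pl_path V E x (vertex_point v) l" if "x \<in> realization V E" for x
    using that unfolding realization_def
  proof
    assume "x \<in> vertex_point ` V"
    with pl_path.refl[OF that] show ?thesis by auto
  next
    assume "x \<in> (\<Union>e\<in>E. cell e)"
    then obtain e where e: "e \<in> E" "x \<in> cell e" by auto
    then obtain u where u: "u \<in> e" using card2[OF e(1)] by fastforce
    then show ?thesis
      using pl_path_edge[OF e(1) u e(2), of "vertex_point u" V] card2[OF e(1)]
        vertex_point_in_cell[of e u] by blast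
  qed
  have walk: "\<exists>l. pl_path V E (vertex_point a) (vertex_point b) l"
    if "(a, b) \<in> {(a, b). {a, b} \<in> E}\<^sup>*" "a \<in> V" for a b
    using that(1)
  proof (induction rule: rtrancl_induct)
    case base
    then show ?case using that by (auto intro!: pl_path.refl exI simp: realization_def)
  next
    case (step b c)
    then obtain l where l: "pl_path V E (vertex_point a) (vertex_point b) l" by auto
    from step have e: "{b, c} \<in> E" by auto
    have "pl_path V E (vertex_point b) (vertex_point c) \<bar>vertex_point b b - vertex_point c b\<bar>"
      by (rule pl_path_edge[OF e]) (use vertex_point_in_cell[OF card2(1)[OF e]] in auto)
    with l show ?case using pl_path_trans by blast
  qed
  obtain a l b k where "a \<in> V" "b \<in> V" "pl_path V E x (vertex_point a) l"
    "pl_path V E y (vertex_point b) k"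
    using vert[OF x] vert[OF y] by auto
  moreover obtain j where "pl_path V E (vertex_point a) (vertex_point b) j"
    using walk G \<open>a \<in> V\<close> \<open>b \<in> V\<close> unfolding connected_graph_def by blast
  ultimately show ?thesis by (meson pl_path_trans pl_path_sym)
qed

lemma bdd_below_pl_path: "bdd_below {l. pl_path V E x y l}"
  using pl_path_nonneg by (auto intro!: bdd_belowI[of _ 0])

lemma graph_dist_lower:
  assumes "connected_graph V E" "x \<in> realization V E" "y \<in> realization V E"
  shows "\<bar>x w - y w\<bar> \<le> graph_dist V E x y"
  unfolding graph_dist_def
  using assms pl_path_exists[OF assms] pl_path_lower[of V E x y _ w]
  by (auto intro!: cInf_greatest simp: connected_graph_def)

lemma graph_dist_le: "pl_path V E x y l \<Longrightarrow> graph_dist V E x y \<le> l"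
  unfolding graph_dist_def
  using pl_path_ends[of V E x y l] by (auto intro!: cInf_lower bdd_below_pl_path)

lemma Metric_space_realization:
  assumes G: "connected_graph V E"
  shows "Metric_space (realization V E) (graph_dist V E)"
proof
  fix x y
  show "0 \<le> graph_dist V E x y"
    using graph_dist_lower[OF G, of x y undefined] abs_ge_zero order_trans
    by (cases "x \<in> realization V E \<and> y \<in> realization V E") (auto simp: graph_dist_def)
  have "{l. pl_path V E x y l} = {l. pl_path V E y x l}" using pl_path_sym by blast
  then show "graph_dist V E x y = graph_dist V E y x" by (auto simp: graph_dist_def)
next
  fix x y assume xy: "x \<in> realization V E" "y \<in> realization V E"
  show "graph_dist V E x y = 0 \<longleftrightarrow> x = y"
  proof
    assume "graph_dist V E x y = 0"
    then show "x = y" using graph_dist_lower[OF G xy] by fastforce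
  next
    assume "x = y"
    then show "graph_dist V E x y = 0"
      using graph_dist_le[OF pl_path.refl[OF xy(1)]] graph_dist_lower[OF G xy] by fastforce
  qed
next
  fix x y z assume xyz: "x \<in> realization V E" "y \<in> realization V E" "z \<in> realization V E"
  have *: "graph_dist V E x z \<le> l + k" if "pl_path V E x y l" "pl_path V E y z k" for l k
    using graph_dist_le pl_path_trans that by blast
  have "graph_dist V E x z - k \<le> Inf {l. pl_path V E x y l}" if "pl_path V E y z k" for k
    by (rule cInf_greatest) (use pl_path_exists[OF G xyz(1,2)] *[OF _ that] in \<open>auto simp: diff_le_eq\<close>)
  then have **: "graph_dist V E x z - k \<le> graph_dist V E x y" if "pl_path V E y z k" for k
    using that xyz by (simp add: graph_dist_def[of V E x y])
  have "graph_dist V E x z - graph_dist V E x y \<le> Inf {k. pl_path V E y z k}"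
    by (rule cInf_greatest) (use pl_path_exists[OF G xyz(2,3)] ** in \<open>auto simp: algebra_simps\<close>)
  then have "graph_dist V E x z - graph_dist V E x y \<le> graph_dist V E y z"
    using xyz by (simp add: graph_dist_def[of V E y z])
  then show "graph_dist V E x z \<le> graph_dist V E x y + graph_dist V E y z" by simp
qed

lemma graph_dist_edge:
  assumes G: "connected_graph V E" and e: "e \<in> E" "u \<in> e" "x \<in> cell e" "y \<in> cell e"
  shows "graph_dist V E x y = \<bar>x u - y u\<bar>"
  using graph_dist_le[OF pl_path_edge[OF e, of V]] graph_dist_lower[OF G, of x y u] e
  by (fastforce simp: realization_def)

end

theory Submission
  imports Defs "HOL-Real_Asymp.Real_Asymp"
begin

text \<open>Both examples come from the ray \<open>0, 1, 2, \<dots>\<close> with additional edges (chords). On level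
  \<open>k\<close> the chords join multiples \<open>s\<^sub>k a\<close>, \<open>s\<^sub>k b\<close> of a scale \<open>s\<^sub>k\<close>, where \<open>(a, b)\<close> runs through a
  matching of \<open>{1..K\<^sub>k}\<close> which turns that stretch of the ray into a cubical grid whose cells have
  diameter about \<open>s\<^sub>k\<close>. All pairs (dimension, side length) occur as levels, and \<open>s\<^sub>k\<close> is
  exponentially large in \<open>K\<^sub>0 + \<dots> + K\<^sub>k\<close>.

  A ball of radius \<open>n\<close> meets at most one chord of the levels with \<open>s\<^sub>k > 2n\<close>, and the other levels
  lie in an initial segment of length \<open>O(n log n)\<close> and carry only \<open>O(log n)\<close> multiples \<open>s\<^sub>k q\<close>,
  \<open>q \<le> K\<^sub>k\<close>. So the graph has growth \<open>O(r log r)\<close>, and the set of all these multiples has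
  logarithmic growth. By Lebesgue's covering theorem, here a consequence of Kuhn's combinatorial
  lemma, a covering of a large \<open>n\<close>-dimensional grid by sets that are small compared with the
  side length has \<open>n + 1\<close> members near a single cell; since the grids occur at unbounded scales
  with distortion depending on \<open>n\<close> only, no linear control function exists.\<close>

subsection \<open>Coverings of grids\<close>

definition grid :: "nat \<Rightarrow> nat \<Rightarrow> (nat \<Rightarrow> nat) set" where
  "grid n p = {..<n} \<rightarrow>\<^sub>E {..p}"

text \<open>A colour meeting the face \<open>x i = 0\<close> avoids the opposite face, so noting for
  each colour which zero faces it meets is a labelling as in Kuhn's lemma. A fully labelled simplex
  lies in one unit cube, and its \<open>n + 1\<close> reduced labels need \<open>n + 1\<close>
  colours.\<close>

lemma kuhn_colouring:
  fixes c :: "(nat \<Rightarrow> nat) \<Rightarrow> 'u"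
  assumes p: "0 < p"
    and c: "\<And>x y i. \<lbrakk>x \<in> grid n p; y \<in> grid n p; i < n; x i = 0; y i = p\<rbrakk> \<Longrightarrow> c x \<noteq> c y"
  obtains q where "q \<in> grid n p"
    "n + 1 \<le> card (c ` {x \<in> grid n p. \<forall>i<n. q i \<le> x i \<and> x i \<le> q i + 1})"
proof -
  \<comment> \<open>\<open>r\<close> turns functions on all natural numbers, as used by
    \<open>kuhn_combinatorial\<close>, into the extensional functions that make up
    \<open>grid\<close>.\<close>
  define r where "r x = restrict x {..<n}" for x :: "nat \<Rightarrow> nat"
  define l :: "'u \<Rightarrow> nat \<Rightarrow> nat"
    where "l U i = (if \<exists>y\<in>grid n p. c y = U \<and> y i = 0 then 0 else 1)" for U i
  define lab where "lab x = l (c (r x))" for x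
  have r: "r x \<in> grid n p" if "\<And>i. i < n \<Longrightarrow> x i \<le> p" for x
    using that by (auto simp: r_def grid_def)
  have "odd (card {s. ksimplex p n s \<and> (reduced n \<circ> lab) ` s = {..n}})"
  proof (rule kuhn_combinatorial[OF p])
    show "\<forall>x j. (\<forall>j. x j \<le> p) \<and> j < n \<and> x j = 0 \<longrightarrow> lab x j = 0"
    proof safe
      fix x j assume "\<forall>j. x j \<le> p" "j < n" "x j = 0"
      then have "r x \<in> grid n p" "r x j = 0" using r by (auto simp: r_def)
      then show "lab x j = 0" by (auto simp: lab_def l_def)
    qed
    show "\<forall>x j. (\<forall>j. x j \<le> p) \<and> j < n \<and> x j = p \<longrightarrow> lab x j = 1"
    proof (intro allI impI, elim conjE)
      fix x j assume "\<forall>j. x j \<le> p" "j < n" "x j = p"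
      then have "r x \<in> grid n p" "r x j = p" using r by (auto simp: r_def)
      then have "c y \<noteq> c (r x)" if "y \<in> grid n p" "y j = 0" for y
        using c[OF that(1) _ \<open>j < n\<close> that(2)] by blast
      then show "lab x j = 1" by (auto simp: lab_def l_def)
    qed
  qed
  then have "{s. ksimplex p n s \<and> (reduced n \<circ> lab) ` s = {..n}} \<noteq> {}"
    by (rule odd_card_imp_not_empty)
  then obtain s b u where "kuhn_simplex p n b u s" and rl: "(reduced n \<circ> lab) ` s = {..n}"
    by (auto elim: ksimplex.cases)
  interpret kuhn_simplex p n b u s by fact
  let ?Q = "{x \<in> grid n p. \<forall>i<n. r b i \<le> x i \<and> x i \<le> r b i + 1}"
  have sub: "r ` s \<subseteq> ?Q"
  proof safe
    fix x assume x: "x \<in> s"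
    then show "r x \<in> grid n p" using s_le_p r by auto
    fix i assume i: "i < n"
    show "r b i \<le> r x i" "r x i \<le> r b i + 1"
      using base_le[OF x, of i] le_Suc_base[OF x, of i] i by (auto simp: r_def)
  qed
  have fin: "finite ?Q"
    by (rule finite_subset[of _ "grid n p"]) (auto simp: grid_def intro: finite_PiE)
  \<comment> \<open>A label depends on the point only through its colour, so different labels force
    different colours.\<close>
  have "(reduced n \<circ> lab) ` s = (\<lambda>U. reduced n (l U)) ` c ` r ` s"
    by (auto simp: lab_def image_iff)
  then have "n + 1 = card ((\<lambda>U. reduced n (l U)) ` c ` r ` s)"
    using rl by simp
  also have "\<dots> \<le> card (c ` r ` s)"
    by (rule card_image_le) (use finite_subset[OF sub fin] in auto)
  also have "\<dots> \<le> card (c ` ?Q)"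
    using sub fin by (intro card_mono) auto
  finally have "n + 1 \<le> card (c ` ?Q)" .
  moreover have "r b \<in> grid n p"
    using base by (intro r) (force simp: Pi_iff)
  ultimately show ?thesis using that by blast
qed

text \<open>As \<open>b\<close> is the same for all \<open>p\<close>, constants \<open>C\<close>,
  \<open>C'\<close> are refuted by a grid with \<open>p > C * b + C'\<close>: for radius
  \<open>b * s\<close> no member of the cover joins opposite faces, so by
  \<open>kuhn_colouring\<close> some ball meets \<open>n + 2\<close> members.\<close>

lemma (in Metric_space) not_asymp_AN_dim_leI:
  assumes b: "0 < b"
    and grids: "\<And>p. 0 < p \<Longrightarrow> \<exists>s\<ge>1. \<exists>\<phi>. \<phi> ` grid (Suc n) p \<subseteq> M \<and>
      (\<forall>x\<in>grid (Suc n) p. \<forall>y\<in>grid (Suc n) p.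
        (\<forall>i<Suc n. x i \<le> y i \<and> y i \<le> x i + 1) \<longrightarrow> d (\<phi> x) (\<phi> y) \<le> b * s) \<and>
      (\<forall>x\<in>grid (Suc n) p. \<forall>y\<in>grid (Suc n) p. \<forall>i<Suc n.
        x i = 0 \<longrightarrow> y i = p \<longrightarrow> s * real p \<le> d (\<phi> x) (\<phi> y))"
  shows "\<not> asymp_AN_dim_le n"
proof
  let ?G = "grid (Suc n)"
  assume "asymp_AN_dim_le n"
  then obtain C C' where C: "C > 0" "C' > 0" and cov: "\<forall>m>0. \<exists>\<U>. \<Union>\<U> = M \<and>
        (\<forall>U\<in>\<U>. \<forall>x\<in>U. \<forall>y\<in>U. d x y \<le> C * m + C') \<and>
        (\<forall>x\<in>M. finite {U\<in>\<U>. U \<inter> mcball x m \<noteq> {}} \<and>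
                card {U\<in>\<U>. U \<inter> mcball x m \<noteq> {}} \<le> n + 1)"
    unfolding asymp_AN_dim_le_def by (elim exE conjE) (erule (2) that)
  obtain p :: nat where p: "C * b + C' < real p"
    using reals_Archimedean2 by blast
  have "0 < C * b" using C b by simp
  with p C have p0: "0 < p" by (cases p) auto
  obtain s \<phi> where s: "s \<ge> 1" and \<phi>: "\<phi> ` ?G p \<subseteq> M"
    and near: "\<And>x y. \<lbrakk>x \<in> ?G p; y \<in> ?G p; \<forall>i<Suc n. x i \<le> y i \<and> y i \<le> x i + 1\<rbrakk>
        \<Longrightarrow> d (\<phi> x) (\<phi> y) \<le> b * s"
    and far: "\<And>x y i. \<lbrakk>x \<in> ?G p; y \<in> ?G p; i < Suc n; x i = 0; y i = p\<rbrakk>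
        \<Longrightarrow> s * real p \<le> d (\<phi> x) (\<phi> y)"
    using grids[OF p0] by (elim exE conjE) (rule that, assumption, assumption, blast, blast)
  from b s have "0 < b * s" by simp
  from cov[rule_format, OF this] obtain \<U> where U: "\<Union>\<U> = M"
    "\<And>U x y. \<lbrakk>U \<in> \<U>; x \<in> U; y \<in> U\<rbrakk> \<Longrightarrow> d x y \<le> C * (b * s) + C'"
    "\<And>x. x \<in> M \<Longrightarrow> finite {U\<in>\<U>. U \<inter> mcball x (b * s) \<noteq> {}}"
    "\<And>x. x \<in> M \<Longrightarrow> card {U\<in>\<U>. U \<inter> mcball x (b * s) \<noteq> {}} \<le> n + 1"
    by (elim exE conjE) (rule that, assumption, blast, blast, blast)
  have "\<forall>x\<in>?G p. \<exists>U\<in>\<U>. \<phi> x \<in> U" using U(1) \<phi> by blast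
  then obtain c where c: "\<And>x. x \<in> ?G p \<Longrightarrow> c x \<in> \<U> \<and> \<phi> x \<in> c x" by metis
  have "c x \<noteq> c y" if "x \<in> ?G p" "y \<in> ?G p" "i < Suc n" "x i = 0" "y i = p" for x y i
  proof
    assume "c x = c y"
    then have "d (\<phi> x) (\<phi> y) \<le> C * (b * s) + C'"
      using c that U(2) by metis
    \<comment> \<open>Here \<open>s \<ge> 1\<close> absorbs the additive constant of the control
      function.\<close>
    also have "\<dots> \<le> (C * b + C') * s"
      using s C by (simp add: algebra_simps)
    also have "\<dots> < s * real p"
      using p s by (simp add: mult.commute)
    finally show False using far[OF that] by simp
  qed
  then obtain q where q: "q \<in> ?G p"
    and card: "Suc n + 1 \<le> card (c ` {x \<in> ?G p. \<forall>i<Suc n. q i \<le> x i \<and> x i \<le> q i + 1})"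
    using kuhn_colouring[OF p0, of "Suc n" c] by blast
  have "c ` {x \<in> ?G p. \<forall>i<Suc n. q i \<le> x i \<and> x i \<le> q i + 1}
      \<subseteq> {U\<in>\<U>. U \<inter> mcball (\<phi> q) (b * s) \<noteq> {}}"
  proof safe
    fix x assume x: "x \<in> ?G p" "\<forall>i<Suc n. q i \<le> x i \<and> x i \<le> q i + 1"
    show "c x \<in> \<U>" using c[OF x(1)] by blast
    have "\<phi> x \<in> c x \<inter> mcball (\<phi> q) (b * s)"
      using c[OF x(1)] near[OF q x] \<phi> q x(1) by auto
    moreover assume "c x \<inter> mcball (\<phi> q) (b * s) = {}"
    ultimately show False by blast
  qed
  moreover have "\<phi> q \<in> M" using q \<phi> by blast
  ultimately have "Suc n + 1 \<le> card {U\<in>\<U>. U \<inter> mcball (\<phi> q) (b * s) \<noteq> {}}"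
    using card card_mono[OF U(3)[of "\<phi> q"]] le_trans by blast
  then show False using U(4)[OF \<open>\<phi> q \<in> M\<close>] by linarith
qed

text \<open>Preimages of a cover satisfy the same diameter bound. Several members may share a
  preimage, so the count of members meeting a ball can only drop.\<close>

lemma asymp_AN_dim_le_isometric_embedding:
  assumes "Metric_space X dX" "Metric_space Y dY"
    and f: "f ` X \<subseteq> Y" and iso: "\<And>x y. \<lbrakk>x \<in> X; y \<in> X\<rbrakk> \<Longrightarrow> dY (f x) (f y) = dX x y"
    and Y: "Metric_space.asymp_AN_dim_le Y dY n"
  shows "Metric_space.asymp_AN_dim_le X dX n"
proof -
  interpret X: Metric_space X dX by fact
  interpret Y: Metric_space Y dY by fact
  obtain C C' where C: "C > 0" "C' > 0" and cov: "\<forall>m>0. \<exists>\<U>. \<Union>\<U> = Y \<and>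
        (\<forall>U\<in>\<U>. \<forall>x\<in>U. \<forall>y\<in>U. dY x y \<le> C * m + C') \<and>
        (\<forall>x\<in>Y. finite {U\<in>\<U>. U \<inter> Y.mcball x m \<noteq> {}} \<and>
                card {U\<in>\<U>. U \<inter> Y.mcball x m \<noteq> {}} \<le> n + 1)"
    using Y unfolding Y.asymp_AN_dim_le_def by (elim exE conjE) (erule (2) that)
  show ?thesis
    unfolding X.asymp_AN_dim_le_def
  proof (rule exI[of _ C], rule conjI[OF C(1)], rule exI[of _ C'], intro conjI C(2) allI impI)
    fix m :: real assume m: "0 < m"
    obtain \<U> where U: "\<Union>\<U> = Y"
      "\<And>U x y. \<lbrakk>U \<in> \<U>; x \<in> U; y \<in> U\<rbrakk> \<Longrightarrow> dY x y \<le> C * m + C'"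
      "\<And>x. x \<in> Y \<Longrightarrow> finite {U\<in>\<U>. U \<inter> Y.mcball x m \<noteq> {}}"
      "\<And>x. x \<in> Y \<Longrightarrow> card {U\<in>\<U>. U \<inter> Y.mcball x m \<noteq> {}} \<le> n + 1"
      using cov[rule_format, OF m]
      by (elim exE conjE) (rule that, assumption, blast, blast, blast)
    let ?g = "\<lambda>U. f -` U \<inter> X"
    have sub: "{W\<in>?g ` \<U>. W \<inter> X.mcball x m \<noteq> {}} \<subseteq> ?g ` {U\<in>\<U>. U \<inter> Y.mcball (f x) m \<noteq> {}}"
      if x: "x \<in> X" for x
    proof
      fix W assume "W \<in> {W\<in>?g ` \<U>. W \<inter> X.mcball x m \<noteq> {}}"
      then obtain U z where U: "U \<in> \<U>" "W = ?g U"
        and z: "f z \<in> U" "z \<in> X" "z \<in> X.mcball x m" by blast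
      then have "f z \<in> Y.mcball (f x) m" using iso[OF x z(2)] f x by auto
      with z U show "W \<in> ?g ` {U\<in>\<U>. U \<inter> Y.mcball (f x) m \<noteq> {}}" by blast
    qed
    have fx: "f x \<in> Y" if "x \<in> X" for x using f that by auto
    show "\<exists>\<W>. \<Union>\<W> = X \<and> (\<forall>U\<in>\<W>. \<forall>x\<in>U. \<forall>y\<in>U. dX x y \<le> C * m + C') \<and>
        (\<forall>x\<in>X. finite {U\<in>\<W>. U \<inter> X.mcball x m \<noteq> {}} \<and>
                card {U\<in>\<W>. U \<inter> X.mcball x m \<noteq> {}} \<le> n + 1)"
    proof (intro exI[of _ "?g ` \<U>"] conjI ballI)
      show "\<Union>(?g ` \<U>) = X" using U(1) f by auto
      show "dX x y \<le> C * m + C'" if W: "W \<in> ?g ` \<U>" and xy: "x \<in> W" "y \<in> W" for W x y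
      proof -
        obtain U where "U \<in> \<U>" "W = ?g U" using W by blast
        then show ?thesis using xy U(2)[of U "f x" "f y"] iso[of x y] by simp
      qed
      fix x assume x: "x \<in> X"
      show "finite {W\<in>?g ` \<U>. W \<inter> X.mcball x m \<noteq> {}}"
        by (rule finite_subset[OF sub[OF x]]) (rule finite_imageI[OF U(3)[OF fx[OF x]]])
      have "card {W\<in>?g ` \<U>. W \<inter> X.mcball x m \<noteq> {}}
          \<le> card {U\<in>\<U>. U \<inter> Y.mcball (f x) m \<noteq> {}}"
        by (rule surj_card_le[OF U(3)[OF fx[OF x]] sub[OF x]])
      also have "\<dots> \<le> n + 1" by (rule U(4)[OF fx[OF x]])
      finally show "card {W\<in>?g ` \<U>. W \<inter> X.mcball x m \<noteq> {}} \<le> n + 1" .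
    qed
  qed
qed

lemma Metric_space_pullback:
  assumes "Metric_space Y d" "inj_on f X" "f ` X \<subseteq> Y"
  shows "Metric_space X (\<lambda>x y. d (f x) (f y))"
proof -
  interpret Metric_space Y d by fact
  show ?thesis
  proof
    show "d (f x) (f y) = 0 \<longleftrightarrow> x = y" if "x \<in> X" "y \<in> X" for x y
      using that assms by (simp add: image_subset_iff inj_on_eq_iff)
    show "d (f x) (f z) \<le> d (f x) (f y) + d (f y) (f z)"
      if "x \<in> X" "y \<in> X" "z \<in> X" for x y z
      using that assms by (auto intro!: triangle)
  qed (auto simp: commute)
qed

subsection \<open>Distances between vertices of a graph\<close>

definition walk :: "'v set set \<Rightarrow> nat \<Rightarrow> 'v \<Rightarrow> 'v \<Rightarrow> bool" where
  "walk E n v w \<longleftrightarrow> (v, w) \<in> {(a, b). {a, b} \<in> E} ^^ n"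

lemma walk_0 [simp]: "walk E 0 v w \<longleftrightarrow> v = w"
  by (auto simp: walk_def)

lemma walk_Suc: "walk E (Suc n) v w \<longleftrightarrow> (\<exists>u. walk E n v u \<and> {u, w} \<in> E)"
  by (auto simp: walk_def)

lemma walk_add: "walk E m u v \<Longrightarrow> walk E n v w \<Longrightarrow> walk E (m + n) u w"
  by (induction n arbitrary: w) (auto simp: walk_Suc)

lemma walk_sym: "walk E n v w \<Longrightarrow> walk E n w v"
proof (induction n arbitrary: w)
  case (Suc n)
  then obtain u where "walk E n v u" "{u, w} \<in> E" by (auto simp: walk_Suc)
  then have "walk E (1 + n) w v"
    using Suc.IH by (intro walk_add[of E 1 w u]) (auto simp: walk_Suc insert_commute)
  then show ?case by simp
qed auto

lemma graph_dist_le_walk: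
  assumes G: "connected_graph V E" and v: "v \<in> V" and walk: "walk E n v w"
  shows "graph_dist V E (vertex_point v) (vertex_point w) \<le> real n"
proof -
  have simple: "simple_graph V E" using G by (simp add: connected_graph_def)
  have "pl_path V E (vertex_point v) (vertex_point w) (real n)"
    using walk
  proof (induction n arbitrary: w)
    case 0
    then show ?case using v by (auto intro!: pl_path.refl simp: realization_def)
  next
    case (Suc n)
    then obtain u where u: "walk E n v u" "{u, w} \<in> E" by (auto simp: walk_Suc)
    have c: "card {u, w} = 2" using simple u by (auto simp: simple_graph_def)
    then have "u \<noteq> w" by auto
    have "pl_path V E (vertex_point u) (vertex_point w)
        \<bar>vertex_point u u - vertex_point w u\<bar>"
      by (rule pl_path_edge[OF u(2)]) (use c in \<open>auto intro: vertex_point_in_cell\<close>)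
    then have "pl_path V E (vertex_point u) (vertex_point w) 1"
      using \<open>u \<noteq> w\<close> by (simp add: vertex_point_def)
    from pl_path_trans[OF Suc.IH[OF u(1)] this] show ?case by (simp add: add.commute)
  qed
  then show ?thesis by (rule graph_dist_le)
qed

text \<open>The affine extension of a function on the vertices to the realization inherits its
  Lipschitz constant.\<close>

lemma pl_path_lipschitz:
  assumes "pl_path V E x y l" and simple: "simple_graph V E"
    and f: "\<And>a b. {a, b} \<in> E \<Longrightarrow> \<bar>f a - f b\<bar> \<le> (1::real)"
  shows "\<bar>(\<Sum>w | x w \<noteq> 0. x w * f w) - (\<Sum>w | y w \<noteq> 0. y w * f w)\<bar> \<le> l"
  using assms(1)
proof (induction rule: pl_path.induct)
  case (step e u x y z l)
  have "card e = 2" using simple step by (auto simp: simple_graph_def)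
  then obtain v where v: "e = {u, v}" "u \<noteq> v"
    using step by (auto simp: card_2_iff doubleton_eq_iff)
  \<comment> \<open>Summing over the support avoids naming an edge; on \<open>cell e\<close> the sum
    is the interpolation between the two endpoints.\<close>
  have ext: "(\<Sum>w | x w \<noteq> 0. x w * f w) = f v + x u * (f u - f v)" if "x \<in> cell e" for x
  proof -
    have "(\<Sum>w | x w \<noteq> 0. x w * f w) = (\<Sum>w\<in>e. x w * f w)"
      using that v by (intro sum.mono_neutral_left) (auto simp: cell_def)
    also have "\<dots> = x u * f u + x v * f v" using v by simp
    also have "x v = 1 - x u" using that v by (auto simp: cell_def)
    finally show ?thesis by (simp add: algebra_simps)
  qed
  have "\<bar>(f v + x u * (f u - f v)) - (f v + y u * (f u - f v))\<bar> = \<bar>x u - y u\<bar> * \<bar>f u - f v\<bar>"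
    by (simp add: abs_mult[symmetric] algebra_simps)
  also have "\<dots> \<le> \<bar>x u - y u\<bar>"
    using f[of u v] step v by (intro mult_left_le) auto
  finally have "\<bar>(\<Sum>w | x w \<noteq> 0. x w * f w) - (\<Sum>w | y w \<noteq> 0. y w * f w)\<bar> \<le> \<bar>x u - y u\<bar>"
    using ext step by simp
  with step.IH show ?case by simp
qed auto

text \<open>At a vertex the affine extension returns \<open>f\<close>, so every path yields the
  bound. The later lower bounds on distances between vertices come from suitable choices of
  \<open>f\<close>.\<close>

lemma lipschitz_le_graph_dist:
  assumes G: "connected_graph V E" and vw: "v \<in> V" "w \<in> V"
    and f: "\<And>a b. {a, b} \<in> E \<Longrightarrow> \<bar>f a - f b\<bar> \<le> (1::real)"
  shows "\<bar>f v - f w\<bar> \<le> graph_dist V E (vertex_point v) (vertex_point w)"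
proof -
  have real: "vertex_point v \<in> realization V E" "vertex_point w \<in> realization V E"
    using vw by (auto simp: realization_def)
  have simple: "simple_graph V E" using G by (simp add: connected_graph_def)
  have supp: "{w. vertex_point v w \<noteq> 0} = {v}" for v :: 'a
    by (auto simp: vertex_point_def indicator_def)
  have "\<bar>f v - f w\<bar> \<le> l" if "pl_path V E (vertex_point v) (vertex_point w) l" for l
    using pl_path_lipschitz[OF that simple f] by (simp add: supp) (simp add: vertex_point_def)
  then show ?thesis
    using pl_path_exists[OF G real] real
    by (auto simp: graph_dist_def intro!: cInf_greatest)
qed

text \<open>The combinatorial distance from \<open>v\<close> changes by at most 1 along an edge, so
  it is itself an admissible function for \<open>lipschitz_le_graph_dist\<close>. This reduces
  metric balls to walks.\<close>

lemma walk_if_graph_dist_le: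
  assumes G: "connected_graph V E" and vw: "v \<in> V" "w \<in> V"
    and le: "graph_dist V E (vertex_point v) (vertex_point w) \<le> r"
  obtains n where "walk E n v w" "real n \<le> r"
proof -
  have simple: "simple_graph V E" using G by (simp add: connected_graph_def)
  define D where "D u = (LEAST n. walk E n v u)" for u
  have ex: "\<exists>n. walk E n v u" if "u \<in> V" for u
    using G vw(1) that rtrancl_imp_relpow unfolding connected_graph_def walk_def by fast
  have walk: "walk E (D u) v u" if "u \<in> V" for u
    using ex[OF that] unfolding D_def by (rule LeastI_ex)
  have step: "D b \<le> Suc (D a)" if "{a, b} \<in> E" for a b
  proof -
    have "a \<in> V" using that simple by (auto simp: simple_graph_def)
    then show ?thesis
      using walk[of a] that unfolding D_def[of b] by (intro Least_le) (auto simp: walk_Suc)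
  qed
  have "\<bar>real (D v) - real (D w)\<bar> \<le> graph_dist V E (vertex_point v) (vertex_point w)"
  proof (rule lipschitz_le_graph_dist[OF G vw])
    fix a b assume "{a, b} \<in> E"
    then show "\<bar>real (D a) - real (D b)\<bar> \<le> 1"
      using step[of a b] step[of b a] by (simp add: insert_commute)
  qed
  moreover have "D v = 0" unfolding D_def by (rule Least_eq_0) simp
  ultimately have "real (D w) \<le> r" using le by simp
  with walk[OF vw(2)] that show ?thesis by blast
qed

subsection \<open>Growth of a ray with sparse chords\<close>

text \<open>\<open>P k\<close> is a partial matching of \<open>{1..K k}\<close>. The condition
  \<open>s_step\<close> separates the stretches used by different levels; \<open>s_exp\<close> makes
  the total size of the levels up to \<open>k\<close> at most logarithmic in
  \<open>s k\<close>.\<close>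

locale chorded_ray =
  fixes s K :: "nat \<Rightarrow> nat" and P :: "nat \<Rightarrow> nat \<Rightarrow> nat \<Rightarrow> bool"
  assumes P_range: "P k a b \<Longrightarrow> 1 \<le> a \<and> a \<le> K k"
    and P_irrefl: "\<not> P k a a"
    and P_sym: "P k a b \<Longrightarrow> P k b a"
    and P_unique: "P k a b \<Longrightarrow> P k a c \<Longrightarrow> b = c"
    and s_step: "2 * s k * (K k + 1) \<le> s (Suc k)"
    and s_exp: "2 ^ (\<Sum>j\<le>k. K j) \<le> s k"
begin

definition chord :: "nat \<Rightarrow> nat \<Rightarrow> bool" where
  "chord v w \<longleftrightarrow> (\<exists>k a b. P k a b \<and> v = s k * a \<and> w = s k * b)"

definition edges :: "nat set set" where
  "edges = {{v, w} | v w. w = Suc v \<or> chord v w}"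

definition mark :: "nat \<Rightarrow> nat \<Rightarrow> bool" where
  "mark k x \<longleftrightarrow> (\<exists>q\<in>{1..K k}. x = s k * q)"

definition marks :: "nat set" where
  "marks = {x. \<exists>k. mark k x}"

text \<open>For \<open>k > 0\<close>, an upper bound for everything marked on levels below
  \<open>k\<close>, still at most half of \<open>s k\<close>.\<close>

definition low :: "nat \<Rightarrow> nat" where
  "low k = (if k = 0 then 0 else s (k - 1) * (K (k - 1) + 1))"

section \<open>Separation of the levels\<close>

lemma s_pos: "0 < s k"
  using s_exp[of k] by (meson less_le_trans zero_less_numeral zero_less_power)

lemma s_mono: "i \<le> j \<Longrightarrow> s i \<le> s j"
proof (rule lift_Suc_mono_le[of s])
  show "s n \<le> s (Suc n)" for n
    using s_step[of n] by (simp add: algebra_simps)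
qed

lemma s_gap: "i < j \<Longrightarrow> 2 * s i * (K i + 1) \<le> s j"
  using s_step[of i] s_mono[of "Suc i" j] by simp

lemma s_unbounded: "k < s k"
proof (induction k)
  case (Suc k)
  then show ?case using s_step[of k] by (simp add: algebra_simps)
qed (rule s_pos)

lemma mark_bounds: "mark k x \<Longrightarrow> s k \<le> x \<and> x \<le> s k * K k"
  by (auto simp: mark_def)

lemma low_le: "2 * low k \<le> s k"
  using s_step[of "k - 1"] by (cases k) (auto simp: low_def algebra_simps)

lemma mark_low:
  assumes "mark j x" "j < k"
  shows "x \<le> low k"
proof -
  have x: "x \<le> s j * K j" using mark_bounds[OF assms(1)] by simp
  show ?thesis
  proof (cases "j = k - 1")
    case True
    with x assms(2) show ?thesis by (simp add: low_def)
  next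
    case False
    then have "2 * s j * (K j + 1) \<le> s (k - 1)" using assms(2) by (intro s_gap) simp
    with x assms(2) show ?thesis by (simp add: low_def algebra_simps)
  qed
qed

lemma mark_less:
  assumes "mark i x" "mark j y" "i < j"
  shows "x + s i \<le> y"
  using s_gap[OF assms(3)] mark_bounds[OF assms(1)] mark_bounds[OF assms(2)]
  by (simp add: algebra_simps)

text \<open>Marks of one level are distinct multiples of its scale; between levels the gap comes
  from \<open>s_step\<close>. Hence an interval of length less than \<open>s k\<close> contains at
  most one mark of the levels from \<open>k\<close> on.\<close>

lemma mark_separated:
  assumes "mark i x" "mark j y" "k \<le> i" "k \<le> j" "x \<noteq> y"
  shows "int (s k) \<le> \<bar>int x - int y\<bar>"
proof (cases i j rule: linorder_cases)
  case less
  then show ?thesis using mark_less[OF assms(1,2)] s_mono[OF assms(3)] by simp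
next
  case greater
  then show ?thesis using mark_less[OF assms(2,1)] s_mono[OF assms(4)] by simp
next
  case equal
  then obtain a b where ab: "x = s i * a" "y = s i * b"
    using assms by (auto simp: mark_def)
  then have "a \<noteq> b" using assms by auto
  then have "1 \<le> \<bar>int a - int b\<bar>" by simp
  then have "int (s i) * 1 \<le> int (s i) * \<bar>int a - int b\<bar>"
    by (intro mult_left_mono) auto
  also have "\<dots> = \<bar>int x - int y\<bar>"
    using ab by (simp add: abs_mult_pos' right_diff_distrib' flip: abs_mult)
  finally show ?thesis using s_mono[OF assms(3)] by simp
qed

lemma mark_unique: "mark i x \<Longrightarrow> mark j x \<Longrightarrow> i = j"
  using mark_less[of i x j x] mark_less[of j x i x] s_pos[of i] s_pos[of j]
  by (cases i j rule: linorder_cases) auto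

lemma chord_marks:
  assumes "chord v w"
  obtains k where "mark k v" "mark k w"
  using assms P_range P_sym unfolding chord_def mark_def by fastforce

lemma chord_sym: "chord v w \<Longrightarrow> chord w v"
  using P_sym unfolding chord_def by blast

text \<open>The level of a chord is determined by its endpoint \<open>v\<close>, as marks of
  different levels are disjoint; on that level the chords form a matching.\<close>

lemma chord_unique:
  assumes "chord v w" "chord v u"
  shows "w = u"
proof -
  obtain k a b where 1: "P k a b" "v = s k * a" "w = s k * b"
    using assms(1) by (auto simp: chord_def)
  obtain l c d where 2: "P l c d" "v = s l * c" "u = s l * d"
    using assms(2) by (auto simp: chord_def)
  have "mark k v" "mark l v" using 1 2 P_range[of k a b] P_range[of l c d]
    by (force simp: mark_def)+
  then have "k = l" by (rule mark_unique)
  then have "a = c" using 1 2 s_pos[of k] by simp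
  then show ?thesis using 1 2 P_unique \<open>k = l\<close> by metis
qed

lemma chord_neq: "chord v w \<Longrightarrow> v \<noteq> w"
  using P_irrefl s_pos unfolding chord_def by (metis mult_cancel1 not_gr_zero)

lemma edge_iff: "{v, w} \<in> edges \<longleftrightarrow> w = Suc v \<or> v = Suc w \<or> chord v w"
  using chord_sym by (auto simp: edges_def doubleton_eq_iff)

lemma walk_ray: "v \<le> w \<Longrightarrow> walk edges (w - v) v w"
proof (induction "w - v" arbitrary: w)
  case (Suc n)
  then obtain u where u: "w = Suc u" "v \<le> u" by (cases w) auto
  with Suc have "walk edges (u - v) v u" by simp
  with u have "walk edges (Suc (u - v)) v w" by (auto simp: walk_Suc edge_iff)
  with u show ?case by (simp add: Suc_diff_le)
qed auto

lemma connected: "connected_graph UNIV edges"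
proof -
  have "\<exists>n. walk edges n u v" for u v
    using walk_ray[of u v] walk_sym[OF walk_ray[of v u]] by (meson nat_le_linear)
  then have "(u, v) \<in> {(a, b). {a, b} \<in> edges}\<^sup>*" for u v
    unfolding walk_def rtrancl_power by blast
  then show ?thesis
    using chord_neq by (auto simp: connected_graph_def simple_graph_def edges_def)
qed

text \<open>Chords of levels below \<open>k\<close> end in the initial segment, and a walk of length
  at most \<open>n\<close> stays too close to its start to reach a second chord of the levels from
  \<open>k\<close> on. What remains is the initial segment and two intervals, around
  \<open>v\<close> and around the far end of that chord.\<close>

lemma walk_cases:
  assumes scale: "2 * n < s k"
  obtains w where "\<And>m z. \<lbrakk>m \<le> n; walk edges m v z\<rbrakk> \<Longrightarrow>
    z \<le> low k + n \<or> \<bar>int z - int v\<bar> \<le> int n \<or> \<bar>int z - int w\<bar> \<le> int n"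
proof -
  define big where "big p \<longleftrightarrow> (\<exists>j\<ge>k. mark j p)" for p
  have big_eq: "p = q" if "big p" "big q" "\<bar>int p - int q\<bar> \<le> 2 * int n" for p q
    using mark_separated[of _ p _ q k] that scale unfolding big_def by fastforce
  have big_chord: "big z" if "chord z z'" "big z'" for z z'
    using that by (metis big_def chord_marks mark_unique)
  have small_chord: "z' \<le> low k" if "chord z z'" "\<not> big z" for z z'
    using that by (metis big_def chord_marks leI mark_low)
  have big_ge: "low k + n < p" if "big p" for p
  proof -
    from that obtain j where "k \<le> j" "mark j p" by (auto simp: big_def)
    then have "s k \<le> p" using mark_bounds[of j p] s_mono[of k j] by simp
    then show ?thesis using low_le[of k] scale by simp
  qed
  \<comment> \<open>The situation after crossing the big chord from \<open>p\<close> to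
    \<open>w\<close>. The 1 pays for the crossing; the distance from \<open>v\<close> to
    \<open>p\<close> is kept for a possible way back.\<close>
  let ?far = "\<lambda>m z. \<exists>p w. big p \<and> chord p w \<and> \<bar>int p - int v\<bar> + \<bar>int z - int w\<bar> + 1 \<le> int m"
  have inv: "z \<le> low k + m \<or> \<bar>int z - int v\<bar> \<le> int m \<or> ?far m z"
    if "m \<le> n" "walk edges m v z" for m z
    using that
  proof (induction m arbitrary: z)
    case (Suc m)
    then obtain y where y: "walk edges m v y" "{y, z} \<in> edges" by (auto simp: walk_Suc)
    have IH: "y \<le> low k + m \<or> \<bar>int y - int v\<bar> \<le> int m \<or> ?far m y"
      using Suc.IH[OF _ y(1)] Suc.prems by simp
    show ?case
    proof (cases "chord y z")
      case False
      then have yz: "\<bar>int z - int y\<bar> \<le> 1" "z \<le> Suc y" using y by (auto simp: edge_iff)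
      from IH show ?thesis
      proof (elim disjE exE conjE)
        fix p w assume "big p" "chord p w" "\<bar>int p - int v\<bar> + \<bar>int y - int w\<bar> + 1 \<le> int m"
        then have "?far (Suc m) z" using yz by (intro exI[of _ p] exI[of _ w]) auto
        then show ?thesis by blast
      qed (use yz in auto)
    next
      case chord: True
      show ?thesis
      proof (cases "big y")
        case False
        then show ?thesis using small_chord[OF chord] by simp
      next
        case True
        from IH show ?thesis
        proof (elim disjE exE conjE)
          assume "y \<le> low k + m"
          then show ?thesis using big_ge[OF True] Suc.prems by simp
        next
          assume "\<bar>int y - int v\<bar> \<le> int m"
          then have "?far (Suc m) z"
            using chord True by (intro exI[of _ y] exI[of _ z]) auto
          then show ?thesis by blast
        next
          \<comment> \<open>Both \<open>y\<close> and \<open>w\<close> are big and less than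
            \<open>s k\<close> apart, hence equal: the chord leads back to \<open>p\<close>.\<close>
          fix p w assume p: "big p" "chord p w" "\<bar>int p - int v\<bar> + \<bar>int y - int w\<bar> + 1 \<le> int m"
          then have "y = w"
            using True big_chord[OF chord_sym] Suc.prems by (intro big_eq) auto
          then have "z = p" using chord_unique chord chord_sym p(2) by blast
          then have "\<bar>int z - int v\<bar> \<le> int (Suc m)" using p(3) by linarith
          then show ?thesis by blast
        qed
      qed
    qed
  qed auto
  show thesis
  \<comment> \<open>At most one big chord end lies within \<open>n\<close> of \<open>v\<close>, so
    its partner \<open>w\<close> serves for all walks. If there is none, \<open>v\<close> itself is
    a harmless choice of \<open>w\<close>.\<close>
  proof (cases "\<exists>p w. big p \<and> chord p w \<and> \<bar>int p - int v\<bar> \<le> int n")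
    case False
    show thesis
    proof (rule that[of v])
      fix m z assume "m \<le> n" "walk edges m v z"
      with inv[OF this] False
      show "z \<le> low k + n \<or> \<bar>int z - int v\<bar> \<le> int n \<or> \<bar>int z - int v\<bar> \<le> int n"
        by fastforce
    qed
  next
    case True
    then obtain p w where p: "big p" "chord p w" "\<bar>int p - int v\<bar> \<le> int n" by blast
    show thesis
    proof (rule that[of w])
      fix m z assume m: "m \<le> n" "walk edges m v z"
      from inv[OF m]
      show "z \<le> low k + n \<or> \<bar>int z - int v\<bar> \<le> int n \<or> \<bar>int z - int w\<bar> \<le> int n"
      proof (elim disjE exE conjE)
        fix q u assume q: "big q" "chord q u" "\<bar>int q - int v\<bar> + \<bar>int z - int u\<bar> + 1 \<le> int m"
        then have "p = q" using p m by (intro big_eq) auto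
        then have "u = w" using chord_unique p q by blast
        then have "\<bar>int z - int w\<bar> \<le> int n" using q(3) m(1) by linarith
        then show ?thesis by blast
      qed (use m in auto)
    qed
  qed
qed

section \<open>Vertices and marks in a ball\<close>

lemma scale_exists:
  assumes "1 \<le> n"
  obtains k where "2 * n < s k" "2 ^ (\<Sum>j<k. K j) \<le> 2 * n"
    "low k \<le> 2 * n * ((\<Sum>j<k. K j) + 1)"
proof -
  \<comment> \<open>By minimality the preceding scale, if any, is at most \<open>2 * n\<close>;
    \<open>s_exp\<close> at that level then bounds the total size of all lower levels.\<close>
  define k where "k = (LEAST k. 2 * n < s k)"
  have k: "2 * n < s k" unfolding k_def by (rule LeastI[of _ "2 * n"]) (rule s_unbounded)
  show thesis
  proof (cases k)
    case 0
    then show ?thesis using that[of k] k assms by (simp add: low_def)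
  next
    case (Suc i)
    then have i: "s i \<le> 2 * n"
      using not_less_Least[of i "\<lambda>k. 2 * n < s k"] unfolding k_def by simp
    have "2 ^ (\<Sum>j<k. K j) \<le> 2 * n"
      using s_exp[of i] i Suc by (simp add: lessThan_Suc_atMost)
    moreover have "low k \<le> 2 * n * ((\<Sum>j<k. K j) + 1)"
    proof -
      have "low k = s i * (K i + 1)" using Suc by (simp add: low_def)
      also have "\<dots> \<le> 2 * n * ((\<Sum>j<k. K j) + 1)"
        using i Suc by (intro mult_le_mono) auto
      finally show ?thesis .
    qed
    ultimately show ?thesis using that k by blast
  qed
qed

lemma near_card:
  "card {z. \<bar>int z - int v\<bar> \<le> int n} \<le> 2 * n + 1" "finite {z. \<bar>int z - int v\<bar> \<le> int n}"
proof -
  have sub: "{z. \<bar>int z - int v\<bar> \<le> int n} \<subseteq> {v - n..v + n}" by auto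
  then show "finite {z. \<bar>int z - int v\<bar> \<le> int n}" by (rule finite_subset) simp
  have "card {z. \<bar>int z - int v\<bar> \<le> int n} \<le> card {v - n..v + n}"
    using sub by (intro card_mono) auto
  then show "card {z. \<bar>int z - int v\<bar> \<le> int n} \<le> 2 * n + 1" by simp
qed

text \<open>\<open>N\<close> is the total size of the levels below the critical scale. Higher levels
  contribute at most one mark to each of the two intervals of \<open>walk_cases\<close>, which gives
  the summand 2.\<close>

lemma ball_card:
  assumes "1 \<le> n"
  obtains N where "2 ^ N \<le> 2 * n" "finite {z. \<exists>m\<le>n. walk edges m v z}"
    "card {z. \<exists>m\<le>n. walk edges m v z} \<le> 2 * n * (N + 1) + 5 * n + 3"
    "card ({z. \<exists>m\<le>n. walk edges m v z} \<inter> marks) \<le> N + 2"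
proof -
  let ?B = "{z. \<exists>m\<le>n. walk edges m v z}" and ?I = "\<lambda>v. {z. \<bar>int z - int v\<bar> \<le> int n}"
  obtain k where k: "2 * n < s k" "2 ^ (\<Sum>j<k. K j) \<le> 2 * n"
    "low k \<le> 2 * n * ((\<Sum>j<k. K j) + 1)"
    by (rule scale_exists[OF assms])
  obtain w where "\<And>m z. \<lbrakk>m \<le> n; walk edges m v z\<rbrakk> \<Longrightarrow>
      z \<le> low k + n \<or> \<bar>int z - int v\<bar> \<le> int n \<or> \<bar>int z - int w\<bar> \<le> int n"
    using walk_cases[OF k(1)] by blast
  then have sub: "?B \<subseteq> {..low k + n} \<union> (?I v \<union> ?I w)" by auto
  have fin: "finite ({..low k + n} \<union> (?I v \<union> ?I w))" using near_card by auto
  have "card ?B \<le> card ({..low k + n} \<union> (?I v \<union> ?I w))" by (rule card_mono[OF fin sub])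
  also have "\<dots> \<le> card {..low k + n} + (card (?I v) + card (?I w))"
    by (meson add_left_mono card_Un_le order_trans)
  also have "\<dots> \<le> (low k + n + 1) + ((2 * n + 1) + (2 * n + 1))"
    using near_card by (intro add_mono) auto
  finally have 1: "card ?B \<le> 2 * n * ((\<Sum>j<k. K j) + 1) + 5 * n + 3" using k(3) by simp
  define big where "big = {x. \<exists>j\<ge>k. mark j x}"
  have big_ge: "low k + n < p" if "p \<in> big" for p
  proof -
    from that obtain j where "k \<le> j" "mark j p" by (auto simp: big_def)
    then have "s k \<le> p" using mark_bounds[of j p] s_mono[of k j] by simp
    then show ?thesis using low_le[of k] k(1) by simp
  qed
  have few: "card (big \<inter> ?I u) \<le> 1" for u
  proof -
    have "p = q" if "p \<in> big \<inter> ?I u" "q \<in> big \<inter> ?I u" for p q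
      using mark_separated[of _ p _ q k] that k(1) unfolding big_def by fastforce
    moreover have "finite (big \<inter> ?I u)" using near_card by simp
    ultimately show ?thesis
      using card_le_Suc0_iff_eq[of "big \<inter> ?I u"] by (metis One_nat_def)
  qed
  have level: "finite {x. mark j x} \<and> card {x. mark j x} \<le> K j" for j
  proof -
    have "{x. mark j x} = (\<lambda>q. s j * q) ` {1..K j}" by (auto simp: mark_def)
    then show ?thesis using card_image_le[of "{1..K j}" "\<lambda>q. s j * q"] by simp
  qed
  have sub': "?B \<inter> marks \<subseteq> (\<Union>j<k. {x. mark j x}) \<union> ((big \<inter> ?I v) \<union> (big \<inter> ?I w))"
  proof
    fix z assume z: "z \<in> ?B \<inter> marks"
    then obtain j where j: "mark j z" by (auto simp: marks_def)
    show "z \<in> (\<Union>j<k. {x. mark j x}) \<union> ((big \<inter> ?I v) \<union> (big \<inter> ?I w))"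
    proof (cases "j < k")
      case False
      then have "z \<in> big" using j by (auto simp: big_def not_less)
      \<comment> \<open>A big mark lies beyond the initial segment, so it is in one of the two
        intervals.\<close>
      then show ?thesis using z sub big_ge[of z] by fastforce
    qed (use j in auto)
  qed
  have "card (?B \<inter> marks) \<le> card ((\<Union>j<k. {x. mark j x}) \<union> ((big \<inter> ?I v) \<union> (big \<inter> ?I w)))"
    by (rule card_mono[OF _ sub']) (use near_card level in auto)
  also have "\<dots> \<le> card (\<Union>j<k. {x. mark j x}) + (card (big \<inter> ?I v) + card (big \<inter> ?I w))"
    by (meson add_left_mono card_Un_le order_trans)
  also have "\<dots> \<le> (\<Sum>j<k. K j) + (1 + 1)"
  proof (intro add_mono few)
    have "card (\<Union>j<k. {x. mark j x}) \<le> (\<Sum>j<k. card {x. mark j x})" by (rule card_UN_le) simp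
    also have "\<dots> \<le> (\<Sum>j<k. K j)" using level by (intro sum_mono) auto
    finally show "card (\<Union>j<k. {x. mark j x}) \<le> (\<Sum>j<k. K j)" .
  qed
  finally have 2: "card (?B \<inter> marks) \<le> (\<Sum>j<k. K j) + 2" by simp
  show thesis using that[OF k(2) finite_subset[OF sub fin] 1 2] .
qed

section \<open>The metric on vertices and the growth bounds\<close>

abbreviation dist_ray :: "nat \<Rightarrow> nat \<Rightarrow> real" where
  "dist_ray v w \<equiv> graph_dist UNIV edges (vertex_point v) (vertex_point w)"

lemma metric_ray: "Metric_space (realization UNIV edges) (graph_dist UNIV edges)"
  by (rule Metric_space_realization[OF connected])

lemma vertex_point_realization: "vertex_point v \<in> realization UNIV edges"
  by (simp add: realization_def)

lemma inj_vertex_point: "inj vertex_point"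
  by (rule injI) (metis indicator_simps(1,2) singletonD singletonI vertex_point_def zero_neq_one)

lemma metric_vertices: "Metric_space UNIV dist_ray"
  by (rule Metric_space_pullback[OF metric_ray])
    (use inj_vertex_point vertex_point_realization in auto)

lemma dist_ray_ball:
  assumes "0 \<le> r"
  shows "{w. dist_ray v w \<le> r} \<subseteq> {w. \<exists>m\<le>nat \<lfloor>r\<rfloor>. walk edges m v w}"
proof
  fix w assume "w \<in> {w. dist_ray v w \<le> r}"
  then obtain m where "walk edges m v w" "real m \<le> r"
    using walk_if_graph_dist_le[OF connected, of v w r] by auto
  moreover then have "m \<le> nat \<lfloor>r\<rfloor>" using assms by linarith
  ultimately show "w \<in> {w. \<exists>m\<le>nat \<lfloor>r\<rfloor>. walk edges m v w}" by blast
qed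

lemma dist_ray_ball_card:
  assumes "1 \<le> r"
  shows "finite {w. dist_ray v w \<le> r}"
    "real (card {w. dist_ray v w \<le> r}) \<le> 2 * r * (log 2 (2 * r) + 1) + 5 * r + 3"
    "real (card ({w. dist_ray v w \<le> r} \<inter> marks)) \<le> log 2 (2 * r) + 2"
proof -
  define n where "n = nat \<lfloor>r\<rfloor>"
  have n: "1 \<le> n" "real n \<le> r" unfolding n_def using assms by linarith+
  let ?B = "{w. \<exists>m\<le>n. walk edges m v w}"
  have sub: "{w. dist_ray v w \<le> r} \<subseteq> ?B"
    using dist_ray_ball[of r v] assms by (simp add: n_def)
  obtain N where N: "2 ^ N \<le> 2 * n" and B: "finite ?B"
    "card ?B \<le> 2 * n * (N + 1) + 5 * n + 3" "card (?B \<inter> marks) \<le> N + 2"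
    using ball_card[OF n(1)] by blast
  have "2 powr real N \<le> real (2 * n)"
    using N by (metis (mono_tags) of_nat_le_iff of_nat_numeral of_nat_power powr_realpow zero_less_numeral)
  also have "\<dots> \<le> 2 * r" using n by simp
  finally have log: "real N \<le> log 2 (2 * r)"
    using assms by (simp add: le_log_iff)
  show "finite {w. dist_ray v w \<le> r}" by (rule finite_subset[OF sub B(1)])
  have "real (card {w. dist_ray v w \<le> r}) \<le> real (2 * n * (N + 1) + 5 * n + 3)"
    using card_mono[OF B(1) sub] B(2) by linarith
  also have "\<dots> = 2 * real n * (real N + 1) + 5 * real n + 3"
    by (simp add: algebra_simps)
  also have "\<dots> \<le> 2 * r * (log 2 (2 * r) + 1) + 5 * r + 3"
    using n log by (intro add_mono mult_mono) auto
  finally show "real (card {w. dist_ray v w \<le> r}) \<le> 2 * r * (log 2 (2 * r) + 1) + 5 * r + 3" .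
  have "card ({w. dist_ray v w \<le> r} \<inter> marks) \<le> card (?B \<inter> marks)"
    using B(1) sub by (intro card_mono) auto
  then show "real (card ({w. dist_ray v w \<le> r} \<inter> marks)) \<le> log 2 (2 * r) + 2"
    using B(3) log by linarith
qed

lemma graph_growth_le:
  assumes "1 \<le> r"
  shows "graph_growth UNIV edges r \<le> ennreal (2 * r * (log 2 (2 * r) + 1) + 5 * r + 3)"
proof -
  interpret Metric_space "realization UNIV edges" "graph_dist UNIV edges" by (rule metric_ray)
  have "{w \<in> UNIV. vertex_point w \<in> mcball (vertex_point v) r} = {w. dist_ray v w \<le> r}" for v
    using vertex_point_realization by auto
  then show ?thesis
    using dist_ray_ball_card[OF assms]
    by (auto simp: graph_growth_def emeasure_count_space_finite ennreal_of_nat_eq_real_of_nat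
        intro!: SUP_least ennreal_leI)
qed

text \<open>Already the whole ball in \<open>marks\<close> has at most
  \<open>log 2 (2 * r) + 2\<close> points, which bounds its intersection with every net. The floor
  decodes a real number back to its vertex.\<close>

lemma net_growth_le:
  assumes "1 \<le> r"
  shows "Metric_space.net_growth (real ` marks) (\<lambda>x y. dist_ray (nat \<lfloor>x\<rfloor>) (nat \<lfloor>y\<rfloor>)) t r
    \<le> ennreal (log 2 (2 * r) + 2)"
proof -
  interpret Metric_space "real ` marks" "\<lambda>x y. dist_ray (nat \<lfloor>x\<rfloor>) (nat \<lfloor>y\<rfloor>)"
    by (rule Metric_space_pullback[OF metric_vertices]) (auto intro!: inj_onI)
  have "emeasure (count_space UNIV) (mcball x r \<inter> N) \<le> ennreal (log 2 (2 * r) + 2)"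
    if x: "x \<in> real ` marks" for x N
  proof -
    obtain v where v: "x = real v" using x by auto
    let ?A = "{w. dist_ray v w \<le> r} \<inter> marks"
    have fin: "finite ?A" using dist_ray_ball_card(1)[OF assms] by simp
    have "mcball x r \<inter> N \<subseteq> real ` ?A" using v by auto
    then have "emeasure (count_space UNIV) (mcball x r \<inter> N) \<le> emeasure (count_space UNIV) (real ` ?A)"
      by (intro emeasure_mono) auto
    also have "\<dots> = ennreal (real (card ?A))"
      using fin by (simp add: emeasure_count_space_finite card_image ennreal_of_nat_eq_real_of_nat)
    also have "\<dots> \<le> ennreal (log 2 (2 * r) + 2)"
      by (intro ennreal_leI dist_ray_ball_card(3) assms)
    finally show ?thesis .
  qed
  then show ?thesis unfolding net_growth_def by (auto intro!: SUP_least)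
qed

end

lemma ennreal_tendsto_zero_divide:
  fixes f :: "real \<Rightarrow> ennreal"
  assumes le: "\<And>r. 1 \<le> r \<Longrightarrow> f r \<le> ennreal (g r)"
    and h: "\<And>r. 1 \<le> r \<Longrightarrow> 0 < h r" and g: "\<And>r. 1 \<le> r \<Longrightarrow> 0 \<le> g r"
    and lim: "((\<lambda>r. g r / h r) \<longlongrightarrow> 0) at_top"
  shows "((\<lambda>r. f r / ennreal (h r)) \<longlongrightarrow> 0) at_top"
proof (rule tendsto_sandwich[where f = "\<lambda>_. 0"])
  show "((\<lambda>r. ennreal (g r / h r)) \<longlongrightarrow> 0) at_top"
    using tendsto_ennrealI[OF lim] by simp
  show "\<forall>\<^sub>F r in at_top. f r / ennreal (h r) \<le> ennreal (g r / h r)"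
    using eventually_ge_at_top[of 1]
  proof eventually_elim
    case (elim r)
    have "f r / ennreal (h r) \<le> ennreal (g r) / ennreal (h r)"
      by (rule divide_right_mono_ennreal[OF le[OF elim]])
    also have "\<dots> = ennreal (g r / h r)"
      by (rule divide_ennreal[OF g[OF elim] h[OF elim]])
    finally show ?case .
  qed
qed auto

context chorded_ray
begin

lemma net_growth_sublinear:
  "((\<lambda>r. Metric_space.net_growth (real ` marks) (\<lambda>x y. dist_ray (nat \<lfloor>x\<rfloor>) (nat \<lfloor>y\<rfloor>)) t r
    / ennreal r) \<longlongrightarrow> 0) at_top"
proof (rule ennreal_tendsto_zero_divide[OF net_growth_le])
  show "((\<lambda>r. (log 2 (2 * r) + 2) / r) \<longlongrightarrow> 0) at_top"
    by real_asymp
qed (auto intro!: add_nonneg_nonneg)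

lemma graph_growth_almost_linear:
  assumes "0 < \<epsilon>"
  shows "((\<lambda>r. graph_growth UNIV edges r / ennreal (r powr (1 + \<epsilon>))) \<longlongrightarrow> 0) at_top"
proof (rule ennreal_tendsto_zero_divide[OF graph_growth_le])
  show "((\<lambda>r. (2 * r * (log 2 (2 * r) + 1) + 5 * r + 3) / r powr (1 + \<epsilon>)) \<longlongrightarrow> 0) at_top"
    using assms by real_asymp
qed (auto intro!: add_nonneg_nonneg mult_nonneg_nonneg)

end

subsection \<open>Grids on the ray\<close>

text \<open>Any order of the cells along the ray will do, because the coordinate functions defined
  later drop to 0 between consecutive cells.\<close>

definition enc :: "nat \<Rightarrow> nat \<Rightarrow> (nat \<Rightarrow> nat) \<Rightarrow> nat" where
  "enc n p = (SOME e. bij_betw e (grid n p) {0..<card (grid n p)})"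

lemma bij_betw_enc: "bij_betw (enc n p) (grid n p) {0..<card (grid n p)}"
proof -
  have "finite (grid n p)" by (auto simp: grid_def intro: finite_PiE)
  then show ?thesis
    unfolding enc_def by (intro someI_ex[of "\<lambda>e. bij_betw e _ _"] ex_bij_betw_finite_nat)
qed

lemma enc_less: "x \<in> grid n p \<Longrightarrow> enc n p x < card (grid n p)"
  using bij_betwE[OF bij_betw_enc, of n p] by auto

lemma inj_on_enc: "inj_on (enc n p) (grid n p)"
  by (rule bij_betw_imp_inj_on[OF bij_betw_enc])

lemma grid_upd: "x \<in> grid n p \<Longrightarrow> j < n \<Longrightarrow> x j < p \<Longrightarrow> x(j := Suc (x j)) \<in> grid n p"
  by (auto simp: grid_def PiE_iff extensional_def)

lemma grid_le: "x \<in> grid n p \<Longrightarrow> j < n \<Longrightarrow> x j \<le> p"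
  by (auto simp: grid_def)

text \<open>Each cell \<open>x\<close> occupies \<open>width n p\<close> consecutive positions. In direction \<open>j\<close> it has an
  entry at \<open>port n p x j\<close> and an exit right after it; the margins on either side are longer
  than the whole grid, so that the ray itself provides no shortcut between cells.\<close>

definition width :: "nat \<Rightarrow> nat \<Rightarrow> nat" where
  "width n p = 2 * p + 2 * n + 4"

definition port :: "nat \<Rightarrow> nat \<Rightarrow> (nat \<Rightarrow> nat) \<Rightarrow> nat \<Rightarrow> nat" where
  "port n p x j = width n p * enc n p x + (p + 2 + 2 * j)"

text \<open>A chord runs from the exit of a cell to the entry of its neighbour in the same
  direction. That exit lies one position after the entry, matching the rise by one unit of the
  coordinate.\<close>

definition link :: "nat \<Rightarrow> nat \<Rightarrow> nat \<Rightarrow> nat \<Rightarrow> bool" where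
  "link n p a b \<longleftrightarrow> (\<exists>x\<in>grid n p. \<exists>j<n. x j < p \<and>
     a = Suc (port n p x j) \<and> b = port n p (x(j := Suc (x j))) j)"

definition grid_chord :: "nat \<Rightarrow> nat \<Rightarrow> nat \<Rightarrow> nat \<Rightarrow> bool" where
  "grid_chord n p a b \<longleftrightarrow> link n p a b \<or> link n p b a"

definition grid_size :: "nat \<Rightarrow> nat \<Rightarrow> nat" where
  "grid_size n p = width n p * card (grid n p)"

lemma mult_add_eq_iff:
  fixes w :: nat
  assumes "w * a + r = w * b + t" "r < w" "t < w"
  shows "a = b" "r = t"
proof -
  have "(w * a + r) div w = a" "(w * b + t) div w = b" using assms(2,3) by simp_all
  then show "a = b" using assms(1) by simp
  then show "r = t" using assms(1) by simp
qed

lemma port_inject: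
  assumes "x \<in> grid n p" "y \<in> grid n p" "i < n" "j < n" "port n p x i = port n p y j"
  shows "x = y" "i = j"
proof -
  have "enc n p x = enc n p y" "p + 2 + 2 * i = p + 2 + 2 * j"
    using mult_add_eq_iff[OF assms(5)[unfolded port_def]] assms(3,4) by (auto simp: width_def)
  then show "x = y" "i = j" using inj_onD[OF inj_on_enc] assms by auto
qed

text \<open>Modulo \<open>width n p\<close>, entries and exits have offsets of different
  parity.\<close>

lemma port_neq_Suc_port:
  assumes "i < n" "j < n"
  shows "port n p x i \<noteq> Suc (port n p y j)"
proof
  assume "port n p x i = Suc (port n p y j)"
  then have *: "width n p * enc n p x + (p + 2 + 2 * i) = width n p * enc n p y + (p + 3 + 2 * j)"
    by (simp add: port_def)
  have "p + 2 + 2 * i = p + 3 + 2 * j"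
    using mult_add_eq_iff(2)[OF *] assms by (auto simp: width_def)
  then show False by presburger
qed

lemma port_less:
  assumes "x \<in> grid n p" "j < n"
  shows "Suc (port n p x j) \<le> grid_size n p"
proof -
  have "Suc (port n p x j) \<le> width n p * Suc (enc n p x)"
    using assms(2) by (simp add: port_def width_def)
  also have "\<dots> \<le> grid_size n p"
    unfolding grid_size_def using enc_less[OF assms(1)] by (intro mult_le_mono) auto
  finally show ?thesis .
qed

lemma port_ge: "1 \<le> port n p x j"
  by (simp add: port_def)

lemma link_range:
  assumes "link n p a b"
  shows "1 \<le> a \<and> a \<le> grid_size n p" "1 \<le> b \<and> b \<le> grid_size n p"
proof -
  from assms obtain x j where x: "x \<in> grid n p" "j < n" "x j < p"
    and ab: "a = Suc (port n p x j)" "b = port n p (x(j := Suc (x j))) j"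
    by (auto simp: link_def)
  show "1 \<le> a \<and> a \<le> grid_size n p" using port_less[OF x(1,2)] ab by simp
  show "1 \<le> b \<and> b \<le> grid_size n p"
    using port_less[OF grid_upd[OF x] x(2)] port_ge ab by simp
qed

text \<open>Links form a partial injection from exits to entries, and no exit is an entry; so their
  symmetrization \<open>grid_chord\<close> is a matching.\<close>

lemma link_unique:
  assumes "link n p a b" "link n p c d"
  shows "a = c \<longleftrightarrow> b = d" "a \<noteq> d"
proof -
  from assms(1) obtain x i where x: "x \<in> grid n p" "i < n" "x i < p"
    and ab: "a = Suc (port n p x i)" "b = port n p (x(i := Suc (x i))) i"
    by (auto simp: link_def)
  from assms(2) obtain y j where y: "y \<in> grid n p" "j < n" "y j < p"
    and cd: "c = Suc (port n p y j)" "d = port n p (y(j := Suc (y j))) j"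
    by (auto simp: link_def)
  show "a \<noteq> d" using port_neq_Suc_port x y ab cd by metis
  show "a = c \<longleftrightarrow> b = d"
  proof
    assume "a = c"
    then show "b = d" using port_inject[OF x(1) y(1) x(2) y(2)] ab cd by simp
  next
    assume "b = d"
    then have eq: "x(i := Suc (x i)) = y(j := Suc (y j))" and "i = j"
      using port_inject[OF grid_upd[OF x] grid_upd[OF y] x(2) y(2)] ab cd by auto
    have "x l = y l" for l
      using fun_cong[OF eq, of l] \<open>i = j\<close> by (cases "l = i") auto
    then have "x = y" by (rule ext)
    then show "a = c" using ab cd \<open>i = j\<close> by simp
  qed
qed

text \<open>The factor \<open>2 * scale K k * (K k + 1)\<close> is dictated by
  \<open>s_step\<close>, the power of 2 by \<open>s_exp\<close>.\<close>

primrec scale :: "(nat \<Rightarrow> nat) \<Rightarrow> nat \<Rightarrow> nat" where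
  "scale K 0 = 2 ^ K 0"
| "scale K (Suc k) = 2 * scale K k * (K k + 1) * 2 ^ K (Suc k)"

lemma scale_ge: "2 ^ (\<Sum>j\<le>k. K j) \<le> scale K k"
proof (induction k)
  case (Suc k)
  have "(2::nat) ^ (\<Sum>j\<le>Suc k. K j) = 2 ^ (\<Sum>j\<le>k. K j) * 2 ^ K (Suc k)"
    by (simp add: power_add)
  also have "\<dots> \<le> (2 * scale K k * (K k + 1)) * 2 ^ K (Suc k)"
    using Suc by (intro mult_le_mono) auto
  finally show ?case by simp
qed simp

lemma chorded_ray_scale:
  fixes rank side K :: "nat \<Rightarrow> nat"
  assumes K: "\<And>k. K k = grid_size (rank k) (side k)"
  shows "chorded_ray (scale K) K (\<lambda>k. grid_chord (rank k) (side k))"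
proof
  fix k a b c
  show "1 \<le> a \<and> a \<le> K k" if "grid_chord (rank k) (side k) a b"
    using that link_range unfolding K grid_chord_def by blast
  show "\<not> grid_chord (rank k) (side k) a a"
    using link_unique(2) unfolding grid_chord_def by blast
  show "grid_chord (rank k) (side k) b a" if "grid_chord (rank k) (side k) a b"
    using that unfolding grid_chord_def by blast
  show "b = c" if "grid_chord (rank k) (side k) a b" "grid_chord (rank k) (side k) a c"
    using that link_unique unfolding grid_chord_def by blast
  show "2 * scale K k * (K k + 1) \<le> scale K (Suc k)" by simp
  show "2 ^ (\<Sum>j\<le>k. K j) \<le> scale K k" by (rule scale_ge)
qed

text \<open>A coordinate function along one cell, lifted from \<open>0\<close> at both ends of the cell to
  \<open>h\<close> before and \<open>h + s\<close> after the position \<open>q\<close>.\<close>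

definition profile :: "int \<Rightarrow> int \<Rightarrow> int \<Rightarrow> int \<Rightarrow> int \<Rightarrow> int" where
  "profile s m q h u = max 0 (min (min (u - s) (m - u)) (h + max 0 (min s (u - q))))"

lemma profile_step: "\<bar>profile s m q h u - profile s m q h (u + 1)\<bar> \<le> 1"
proof -
  have min: "\<bar>min a b - min a' b'\<bar> \<le> 1" and max: "\<bar>max a b - max a' b'\<bar> \<le> 1"
    if "\<bar>a - a'\<bar> \<le> 1" "\<bar>b - b'\<bar> \<le> 1" for a a' b b' :: int
    using that by (auto simp: min_def max_def)
  have add: "\<bar>(h + a) - (h + a')\<bar> \<le> 1" if "\<bar>a - a'\<bar> \<le> 1" for a a' :: int
    using that by simp
  show ?thesis unfolding profile_def by (intro min max add) auto
qed

text \<open>These values allow profiles of consecutive cells to be glued with jumps of at most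
  1.\<close>

lemma profile_ends: "u \<le> s \<Longrightarrow> profile s m q h u = 0" "0 \<le> profile s m q h u"
  "u + 1 = m \<Longrightarrow> profile s m q h u \<le> 1"
  by (auto simp: profile_def)

text \<open>The margins are used here: at least \<open>p + 2\<close> units from the left end and
  \<open>p + 1\<close> from the right, the two slopes exceed every possible height, so only the
  plateau and its step at \<open>q\<close> remain.\<close>

lemma profile_port:
  fixes s :: int
  assumes s: "0 \<le> s" and h: "0 \<le> h" "h \<le> p" and u: "p + 2 \<le> u" "u + p + 1 \<le> w"
  shows "profile s (s * w) (s * q) (s * h) (s * u) = s * h + (if q < u then s else 0)"
proof -
  have "s * (h + 1) \<le> s * (u - 1)" "s * (h + 1) \<le> s * (w - u)"
    using assms by (auto intro!: mult_left_mono)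
  then have 1: "s * h + s \<le> s * u - s" "s * h + s \<le> s * w - s * u"
    by (simp_all add: algebra_simps)
  have 0: "0 \<le> s * h" using s h by simp
  show ?thesis
  proof (cases "q < u")
    case True
    then have "s * (q + 1) \<le> s * u" using s by (intro mult_left_mono) auto
    then have "s * q + s \<le> s * u" by (simp add: algebra_simps)
    then show ?thesis using 0 1 s True unfolding profile_def by (simp add: max_def min_def)
  next
    case False
    then have "s * u \<le> s * q" using s by (intro mult_left_mono) auto
    then show ?thesis using 0 1 s False unfolding profile_def by (simp add: max_def min_def)
  qed
qed

section \<open>Embedded grids and their coordinate functions\<close>

context chorded_ray
begin

context
  fixes k n p :: nat
  assumes P_k: "P k = grid_chord n p" and K_k: "K k = grid_size n p"
begin

text \<open>This is the entry position for direction 0. It precedes the step of every coordinate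
  function, so there \<open>height i\<close> is exactly \<open>s k * x i\<close>.\<close>

definition site :: "(nat \<Rightarrow> nat) \<Rightarrow> nat" where
  "site x = s k * (width n p * enc n p x + (p + 2))"

lemma site_marks:
  assumes "x \<in> grid n p"
  shows "site x \<in> marks"
proof -
  have "width n p * enc n p x + (p + 2) \<le> width n p * Suc (enc n p x)"
    by (simp add: width_def)
  also have "\<dots> \<le> K k"
    unfolding K_k grid_size_def using enc_less[OF assms] by (intro mult_le_mono) auto
  finally show ?thesis unfolding marks_def mark_def site_def by force
qed

lemma dist_site_step:
  assumes x: "x \<in> grid n p" "j < n" "x j < p"
  shows "dist_ray (site x) (site (x(j := Suc (x j)))) \<le> real (4 * n * s k)"
proof -
  let ?y = "x(j := Suc (x j))"
  let ?a = "s k * Suc (port n p x j)" and ?b = "s k * port n p ?y j"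
  \<comment> \<open>The route follows the ray to the exit in direction \<open>j\<close>, takes the
    chord, and returns along the ray from the neighbour's entry to its site.\<close>
  have a: "?a = site x + s k * (2 * j + 1)" and b: "?b = site ?y + s k * (2 * j)"
    by (simp_all add: port_def site_def algebra_simps)
  have "walk edges (s k * (2 * j + 1)) (site x) ?a"
    using walk_ray[of "site x" ?a] a by simp
  moreover have "chord ?a ?b"
  proof -
    have "P k (Suc (port n p x j)) (port n p ?y j)"
      unfolding P_k grid_chord_def link_def using x by blast
    then show ?thesis unfolding chord_def by blast
  qed
  then have "walk edges 1 ?a ?b" by (simp add: walk_Suc edge_iff)
  moreover have "walk edges (s k * (2 * j)) ?b (site ?y)"
    using walk_sym[OF walk_ray[of "site ?y" ?b]] b by simp
  ultimately have "walk edges (s k * (2 * j + 1) + 1 + s k * (2 * j)) (site x) (site ?y)"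
    by (blast intro: walk_add)
  from graph_dist_le_walk[OF connected _ this]
  have "dist_ray (site x) (site ?y) \<le> real (s k * (2 * j + 1) + 1 + s k * (2 * j))" by simp
  also have "s k * (2 * j + 1) + 1 + s k * (2 * j) \<le> 4 * (j + 1) * s k"
    using s_pos[of k] by (simp add: algebra_simps)
  also have "\<dots> \<le> 4 * n * s k"
    using x(2) by (intro mult_le_mono) auto
  finally show ?thesis by simp
qed

lemma dist_site_le:
  assumes x: "x \<in> grid n p" and y: "y \<in> grid n p"
    and xy: "\<forall>i<n. x i \<le> y i \<and> y i \<le> x i + 1"
  shows "dist_ray (site x) (site y) \<le> real n * real (4 * n * s k)"
proof -
  interpret Metric_space UNIV dist_ray by (rule metric_vertices)
  \<comment> \<open>The coordinates of \<open>x\<close> are replaced by those of \<open>y\<close>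
    one at a time, each at the cost of at most one grid step.\<close>
  define h where "h t = (\<lambda>i. if i < t then y i else x i)" for t :: nat
  have "h t \<in> grid n p \<and> dist_ray (site x) (site (h t)) \<le> real t * real (4 * n * s k)"
    if "t \<le> n" for t
    using that
  proof (induction t)
    case 0
    then show ?case using x by (simp add: h_def)
  next
    case (Suc t)
    then have IH: "h t \<in> grid n p"
      "dist_ray (site x) (site (h t)) \<le> real t * real (4 * n * s k)" by auto
    have upd: "h (Suc t) = (h t)(t := y t)" and ht: "h t t = x t"
      by (auto simp: h_def less_Suc_eq)
    have "y t = x t \<or> y t = Suc (x t)" using xy[rule_format, of t] Suc.prems by linarith
    then have "h (Suc t) = h t \<or> h (Suc t) = (h t)(t := Suc (h t t)) \<and> h t t < p"
      using upd ht grid_le[OF y, of t] Suc.prems by (auto simp: fun_upd_idem)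
    then have "h (Suc t) \<in> grid n p \<and>
        dist_ray (site (h t)) (site (h (Suc t))) \<le> real (4 * n * s k)"
      using IH(1) grid_upd[of "h t" n p t] dist_site_step[of "h t" t] Suc.prems by auto
    moreover have "dist_ray (site x) (site (h (Suc t)))
        \<le> dist_ray (site x) (site (h t)) + dist_ray (site (h t)) (site (h (Suc t)))"
      by (rule triangle) auto
    ultimately show ?case using IH(2) by (auto simp: algebra_simps)
  qed
  moreover have "h n = y"
    using x y by (auto simp: h_def fun_eq_iff grid_def PiE_iff extensional_def)
  ultimately show ?thesis by (metis order_refl)
qed

definition cell_length :: nat where
  "cell_length = s k * width n p"

text \<open>An extension of the scaled grid coordinate \<open>s k * x i\<close> to all vertices of
  the ray, which will turn out to change by at most 1 along every edge. Beyond the cells of the grid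
  it is 0.\<close>

definition height :: "nat \<Rightarrow> nat \<Rightarrow> int" where
  "height i v = (if v div cell_length \<in> enc n p ` grid n p
     then profile (s k) cell_length (s k * (p + 2 + 2 * i))
       (s k * inv_into (grid n p) (enc n p) (v div cell_length) i) (v mod cell_length)
     else 0)"

lemma cell_length_gt: "s k < cell_length"
  using s_pos[of k] by (simp add: cell_length_def width_def)

lemma height_step: "\<bar>height i v - height i (Suc v)\<bar> \<le> 1"
proof (cases "Suc v mod cell_length = 0")
  case False
  then have "Suc v div cell_length = v div cell_length"
    "int (Suc v mod cell_length) = int (v mod cell_length) + 1"
    by (auto simp: div_Suc mod_Suc split: if_splits)
  then show ?thesis using profile_step by (simp add: height_def)
next
  \<comment> \<open>The next position starts a new cell, where the height is 0; the last position of
    the old cell has height at most 1.\<close>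
  case True
  then have "int (v mod cell_length) + 1 = int cell_length"
    by (auto simp: mod_Suc split: if_splits)
  then have "0 \<le> height i v" "height i v \<le> 1"
    by (auto simp: height_def profile_ends)
  moreover have "height i (Suc v) = 0"
    using True by (simp add: height_def profile_ends)
  ultimately show ?thesis by simp
qed

lemma height_cell:
  assumes x: "x \<in> grid n p" and i: "i < n" and u: "p + 2 \<le> u" "u + p + 1 \<le> width n p"
  shows "height i (s k * (width n p * enc n p x + u))
    = int (s k * x i) + (if p + 2 + 2 * i < u then int (s k) else 0)"
proof -
  let ?v = "s k * (width n p * enc n p x + u)"
  have div: "?v div cell_length = enc n p x"
    using u s_pos[of k] by (simp add: cell_length_def)
  have mod: "?v mod cell_length = s k * u"
    using u s_pos[of k] by (simp add: cell_length_def mult_mod_right[symmetric])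
  have "height i ?v = profile (int (s k)) (int (s k) * int (width n p))
      (int (s k) * int (p + 2 + 2 * i)) (int (s k) * int (x i)) (int (s k) * int u)"
    using x inv_into_f_f[OF inj_on_enc x]
    unfolding height_def div mod by (simp add: cell_length_def algebra_simps)
  also have "\<dots> = int (s k) * int (x i) + (if int (p + 2 + 2 * i) < int u then int (s k) else 0)"
    using grid_le[OF x i] u by (intro profile_port[where p = "int p"]) auto
  finally show ?thesis by (simp only: of_nat_less_iff of_nat_mult)
qed

text \<open>In the direction of the link, the step passed at the exit makes up for the larger
  coordinate at the entry. In any other direction the coordinate agrees and both ends lie on the
  same side of the step.\<close>

lemma height_link:
  assumes "link n p a b" "i < n"
  shows "height i (s k * a) = height i (s k * b)"
proof -
  from assms(1) obtain x j where x: "x \<in> grid n p" "j < n" "x j < p"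
    and ab: "a = Suc (port n p x j)" "b = port n p (x(j := Suc (x j))) j"
    by (auto simp: link_def)
  have a: "a = width n p * enc n p x + (p + 3 + 2 * j)" using ab by (simp add: port_def)
  have "height i (s k * a)
      = int (s k * x i) + (if p + 2 + 2 * i < p + 3 + 2 * j then int (s k) else 0)"
    unfolding a using x by (intro height_cell assms) (auto simp: width_def)
  moreover have "height i (s k * b)
      = int (s k * (x(j := Suc (x j))) i)
        + (if p + 2 + 2 * i < p + 2 + 2 * j then int (s k) else 0)"
    unfolding ab port_def using x by (intro height_cell grid_upd assms) (auto simp: width_def)
  ultimately show ?thesis
    by (cases i j rule: linorder_cases) (simp_all add: algebra_simps)
qed

text \<open>Lower levels lie within \<open>s k\<close> of the origin, where the profile has not yet
  left 0; higher levels lie beyond all cells of the grid.\<close>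

lemma height_other_level:
  assumes "mark l v" "l \<noteq> k"
  shows "height i v = 0"
proof (cases "l < k")
  case True
  then have "v \<le> s k" using mark_low[OF assms(1)] low_le[of k] by fastforce
  then show ?thesis
    using cell_length_gt by (simp add: height_def profile_ends)
next
  case False
  then have "2 * s k * (K k + 1) \<le> v"
    using s_gap[of k l] mark_bounds[OF assms(1)] assms(2) by simp
  then have "card (grid n p) * cell_length \<le> v"
    by (simp add: K_k grid_size_def cell_length_def algebra_simps)
  then have "card (grid n p) \<le> v div cell_length"
    using cell_length_gt by (simp add: less_eq_div_iff_mult_less_eq)
  then have "v div cell_length \<notin> enc n p ` grid n p"
    using enc_less by fastforce
  then show ?thesis by (simp add: height_def)
qed

lemma height_chord:
  assumes "chord v w" "i < n"
  shows "height i v = height i w"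
proof -
  from assms(1) obtain l a b where l: "P l a b" "v = s l * a" "w = s l * b"
    by (auto simp: chord_def)
  show ?thesis
  proof (cases "l = k")
    case True
    then show ?thesis using l height_link[OF _ assms(2)] by (auto simp: P_k grid_chord_def)
  next
    case False
    have "mark l v" "mark l w"
      using l P_range[of l a b] P_range[OF P_sym, of l a b] by (force simp: mark_def)+
    then show ?thesis using height_other_level False by simp
  qed
qed

text \<open>Ray edges change \<open>height i\<close> by at most 1 and chords of all levels preserve
  it, so \<open>lipschitz_le_graph_dist\<close> applies.\<close>

lemma dist_site_ge:
  assumes x: "x \<in> grid n p" and y: "y \<in> grid n p" and i: "i < n"
  shows "real (s k) * \<bar>real (x i) - real (y i)\<bar> \<le> dist_ray (site x) (site y)"
proof -
  have *: "height i (site x) = int (s k * x i)" if "x \<in> grid n p" for x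
    unfolding site_def using that i by (subst height_cell) (auto simp: width_def)
  have lip: "\<bar>height i v - height i w\<bar> \<le> 1" if "{v, w} \<in> edges" for v w
    using that height_step[of i v] height_step[of i w] height_chord[OF _ i, of v w]
    by (auto simp: edge_iff abs_minus_commute)
  have "\<bar>real_of_int (height i (site x)) - real_of_int (height i (site y))\<bar>
      \<le> dist_ray (site x) (site y)"
  proof (rule lipschitz_le_graph_dist[OF connected])
    fix v w assume "{v, w} \<in> edges"
    then have "real_of_int \<bar>height i v - height i w\<bar> \<le> real_of_int 1"
      using lip by (simp only: of_int_le_iff)
    then show "\<bar>real_of_int (height i v) - real_of_int (height i w)\<bar> \<le> 1" by simp
  qed auto
  also have "\<bar>real_of_int (height i (site x)) - real_of_int (height i (site y))\<bar>
      = \<bar>real (s k) * (real (x i) - real (y i))\<bar>"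
    using * x y by (simp add: algebra_simps)
  finally show ?thesis by (simp add: abs_mult)
qed

end

lemma infinite_asymp_AN_dim_marks:
  assumes grids: "\<And>n p. \<exists>k. P k = grid_chord n p \<and> K k = grid_size n p"
  shows "Metric_space.infinite_asymp_AN_dim (real ` marks)
    (\<lambda>x y. dist_ray (nat \<lfloor>x\<rfloor>) (nat \<lfloor>y\<rfloor>))"
proof -
  interpret Metric_space "real ` marks" "\<lambda>x y. dist_ray (nat \<lfloor>x\<rfloor>) (nat \<lfloor>y\<rfloor>)"
    by (rule Metric_space_pullback[OF metric_vertices]) (auto intro!: inj_onI)
  have "\<not> asymp_AN_dim_le n" for n
  \<comment> \<open>The constant is that of \<open>dist_site_le\<close>: \<open>Suc n\<close> grid
    steps of length at most \<open>4 * Suc n * s k\<close> each. It depends neither on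
    \<open>p\<close> nor on the level.\<close>
  proof (rule not_asymp_AN_dim_leI[where b = "4 * real (Suc n) * real (Suc n)"])
    fix p :: nat
    obtain k where k: "P k = grid_chord (Suc n) p" "K k = grid_size (Suc n) p"
      using grids by blast
    let ?f = "\<lambda>x. real (site k (Suc n) p x)"
    show "\<exists>s\<ge>1. \<exists>\<phi>. \<phi> ` grid (Suc n) p \<subseteq> real ` marks \<and>
      (\<forall>x\<in>grid (Suc n) p. \<forall>y\<in>grid (Suc n) p.
        (\<forall>i<Suc n. x i \<le> y i \<and> y i \<le> x i + 1) \<longrightarrow>
        dist_ray (nat \<lfloor>\<phi> x\<rfloor>) (nat \<lfloor>\<phi> y\<rfloor>) \<le> 4 * real (Suc n) * real (Suc n) * s) \<and>
      (\<forall>x\<in>grid (Suc n) p. \<forall>y\<in>grid (Suc n) p. \<forall>i<Suc n.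
        x i = 0 \<longrightarrow> y i = p \<longrightarrow> s * real p \<le> dist_ray (nat \<lfloor>\<phi> x\<rfloor>) (nat \<lfloor>\<phi> y\<rfloor>))"
    proof (rule exI[of _ "real (s k)"], rule conjI, goal_cases)
      case 1
      then show ?case using s_pos[of k] by simp
    next
      case 2
      show ?case
      proof (rule exI[of _ ?f], intro conjI ballI allI impI)
        show "?f ` grid (Suc n) p \<subseteq> real ` marks" using site_marks[OF k] by auto
      next
        fix x y assume "x \<in> grid (Suc n) p" "y \<in> grid (Suc n) p"
          "\<forall>i<Suc n. x i \<le> y i \<and> y i \<le> x i + 1"
        from dist_site_le[OF k this]
        show "dist_ray (nat \<lfloor>?f x\<rfloor>) (nat \<lfloor>?f y\<rfloor>) \<le> 4 * real (Suc n) * real (Suc n) * real (s k)"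
          by (simp add: algebra_simps)
      next
        fix x y i assume "x \<in> grid (Suc n) p" "y \<in> grid (Suc n) p" "i < Suc n"
          and "x i = 0" "y i = p"
        with dist_site_ge[OF k this(1-3)]
        show "real (s k) * real p \<le> dist_ray (nat \<lfloor>?f x\<rfloor>) (nat \<lfloor>?f y\<rfloor>)" by simp
      qed
    qed
  qed simp
  then show ?thesis by (simp add: infinite_asymp_AN_dim_def)
qed

end

theorem theorem3p5:
  "(\<exists>(M :: real set) d. Metric_space M d \<and>
      ((\<lambda>r. Metric_space.net_growth M d 1 r / ennreal r) \<longlongrightarrow> 0) at_top \<and>
      Metric_space.infinite_asymp_AN_dim M d)
   \<and>
   (\<exists>(V :: nat set) E. connected_graph V E \<and>
      (\<forall>\<epsilon>::real>0. ((\<lambda>r. graph_growth V E r / ennreal (r powr (1 + \<epsilon>))) \<longlongrightarrow> 0) at_top) \<and>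
      Metric_space.infinite_asymp_AN_dim (realization V E) (graph_dist V E))"
proof -
  \<comment> \<open>Decoding pairs lets every combination of dimension and side length occur as a
    level.\<close>
  define rank side where "rank k = fst (prod_decode k)" and "side k = snd (prod_decode k)" for k
  define K where "K k = grid_size (rank k) (side k)" for k
  interpret chorded_ray "scale K" K "\<lambda>k. grid_chord (rank k) (side k)"
    by (rule chorded_ray_scale) (rule K_def)
  let ?d = "\<lambda>x y. dist_ray (nat \<lfloor>x\<rfloor>) (nat \<lfloor>y\<rfloor>)"
  have metric: "Metric_space (real ` marks) ?d"
    by (rule Metric_space_pullback[OF metric_vertices]) (auto intro!: inj_onI)
  have infinite: "Metric_space.infinite_asymp_AN_dim (real ` marks) ?d"
  proof (rule infinite_asymp_AN_dim_marks)
    fix n p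
    show "\<exists>k. grid_chord (rank k) (side k) = grid_chord n p \<and> K k = grid_size n p"
      by (rule exI[of _ "prod_encode (n, p)"]) (simp add: K_def rank_def side_def)
  qed
  have "Metric_space.infinite_asymp_AN_dim (realization UNIV edges) (graph_dist UNIV edges)"
    \<comment> \<open>The metric space of part (1) sits isometrically in the realization, so a bound
      for the graph would bound it as well.\<close>
    using infinite asymp_AN_dim_le_isometric_embedding[OF metric metric_ray,
        of "\<lambda>x. vertex_point (nat \<lfloor>x\<rfloor>)"] vertex_point_realization
    unfolding Metric_space.infinite_asymp_AN_dim_def[OF metric]
      Metric_space.infinite_asymp_AN_dim_def[OF metric_ray] by blast
  then show ?thesis
    using metric infinite net_growth_sublinear connected graph_growth_almost_linear by blast
qed

end
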